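(* Let $\sigma>0$ and let $\mathbb{R}^{d} = \bigcup_{j=1}^{\infty} I_{j}$ be a partition of $\mathbb{R}^{d}$ into bounded convex sets with nonempty interior such that $K:=\sup_{j}\mathrm{diam}(I_{j})<\infty$ and $M_{j}:=\sup_{x\in I_{j}} \|x\|\geq 1$ for all $j$. Let $P$ be a Borel probability measure on $\mathbb{R}^d$ with finite second moment such that $\sum_{j=1}^{\infty} M_{j}P(I_{j})^{1/2} < \infty$. Then $$\mathbb{E}\big[\mathsf{W}_1^{\sigma} (P_{n},P)\big] \lesssim_{d,K} \frac{\sigma^{-d/2+1}\log n}{\sqrt{n}} \sum_{j=1}^{\infty} M_{j}P(I_{j})^{1/2}.$$
   Context: $\|\cdot\|$ is the Euclidean norm on $\mathbb{R}^d$, and $\mathrm{diam}(I)=\sup_{x,y\in I}\|x-y\|$. The notation $a\lesssim_{x} b$ means $a\le C_x b$ for a constant $C_x$ depending only on $x$. $\mathcal{N}_\sigma=\mathcal N(0,\sigma^2 \mathrm{I}_d)$, and $\ast$ denotes convolution. $\mathsf{W}_1(P,Q)=\inf_\pi\int\|x-y\|\,\mathrm{d}\pi(x,y)$ (infimum over couplings $\pi$ of $P$ and $Q$) is the 1-Wasserstein distance, and $\mathsf{W}_1^{\sigma}(P,Q):=\mathsf{W}_1(P\ast\mathcal{N}_\sigma,Q\ast\mathcal{N}_\sigma)$. $P_n=n^{-1}\sum_{i=1}^n\delta_{X_i}$ is the empirical measure of i.i.d. samples $X_1,\dots,X_n$ from $P$.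
   Formalization: As stated, no constant depending only on d, K works for all σ (σ→∞ if d≥3, σ→0 if d=1), and n=1 gives log n=0; here n≥2 and the constant also depends on an arbitrary c>0, uniformly over σ with σ^{-d/2+1}≥c; the sets I_j are assumed Borel. *)

theory Defs
  imports "HOL-Probability.Probability"
begin

definition isotropic_gaussian :: "real \<Rightarrow> (real ^ 'n) measure" where
  "isotropic_gaussian \<sigma> =
     density lborel (\<lambda>x. ennreal (\<Prod>i\<in>UNIV. normal_density 0 \<sigma> (x $ i)))"

definition couplings :: "'a measure \<Rightarrow> 'b measure \<Rightarrow> ('a \<times> 'b) measure set" where
  "couplings P Q = {\<pi>. sets \<pi> = sets (P \<Otimes>\<^sub>M Q) \<and> distr \<pi> P fst = P \<and> distr \<pi> Q snd = Q}"

text \<open>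
  The distance takes values in \<^typ>\<open>ennreal\<close>, so that it is meaningful without any moment
  assumption on the two measures.
\<close>

definition wasserstein1 ::
    "'a::metric_space measure \<Rightarrow> 'a measure \<Rightarrow> ennreal" where
  "wasserstein1 P Q = (INF \<pi>\<in>couplings P Q. \<integral>\<^sup>+ (x, y). ennreal (dist x y) \<partial>\<pi>)"

definition smooth_wasserstein1 ::
    "real \<Rightarrow> (real ^ 'n) measure \<Rightarrow> (real ^ 'n) measure \<Rightarrow> ennreal" where
  "smooth_wasserstein1 \<sigma> P Q =
     wasserstein1 (P \<star> isotropic_gaussian \<sigma>) (Q \<star> isotropic_gaussian \<sigma>)"

text \<open>
  The empirical measure of the points \<open>x 0, \<dots>, x (n - 1)\<close> is the law of \<open>x i\<close> for an index \<open>i\<close>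
  drawn uniformly from \<open>{..<n}\<close>; the lemma below states the usual formula, an average of
  point masses.
\<close>

definition empirical_measure ::
    "nat \<Rightarrow> (nat \<Rightarrow> 'a::topological_space) \<Rightarrow> 'a measure" where
  "empirical_measure n x = distr (uniform_count_measure {..<n}) borel x"

lemma measure_empirical_measure:
  assumes "A \<in> sets borel"
  shows "measure (empirical_measure n x) A = (\<Sum>i<n. indicator A (x i)) / real n"
proof -
  have "x \<in> measurable (uniform_count_measure {..<n}) borel"
    by (simp add: measurable_def sets_uniform_count_measure space_uniform_count_measure)
  then have "measure (empirical_measure n x) A
      = measure (uniform_count_measure {..<n}) (x -` A \<inter> {..<n})"
    using assms by (simp add: empirical_measure_def measure_distr space_uniform_count_measure)
  also have "\<dots> = card (x -` A \<inter> {..<n}) / card {..<n}"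
    by (rule measure_uniform_count_measure) auto
  also have "real (card (x -` A \<inter> {..<n})) = (\<Sum>i<n. indicator A (x i))"
    by (simp add: indicator_def sum.If_cases Int_def vimage_def conj_commute)
  finally show ?thesis
    by simp
qed

end

theory Submission
  imports Defs
begin

text \<open>
  The two measures are coupled greedily along the dyadic cubes of sides \<open>2 ^ -m, \<dots>, 1/2, 1\<close>:
  whatever mass can be matched within the smallest cubes is matched there, the rest within the cubes
  of the next size, and so on; what remains after the unit cubes is matched arbitrarily. The mass
  left over after one level is the sum of the differences of the masses of its cubes. For a smoothed
  empirical measure such a difference is the fluctuation of an i.i.d. mean, of order
  \<open>sqrt (s * \<mu> Q / n)\<close>, where \<open>s\<close> bounds the probability that the noise moves a given point into \<open>Q\<close>.
  Summed over the \<open>2 ^ (k * d)\<close> subcubes of a unit cube by the Cauchy-Schwarz inequality, with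
  \<open>s = min 1 (2 ^ (- k * d) * \<sigma> ^ -d)\<close>, and multiplied by the side of the cubes, every level
  contributes at most \<open>\<sigma> ^ (1 - d / 2) / sqrt n\<close> times the sum of the \<open>sqrt (\<mu> Q)\<close> over the unit
  cubes. About \<open>log n\<close> levels suffice. The last sum is compared with that over the given partition
  using the exponential moments of the noise. In dimension at most 2 no noise is needed.
\<close>

section \<open>Greedy couplings\<close>

text \<open>For fixed \<open>n\<close> and d >= 3 the factor \<sigma>^(1 - d/2) tends to 0 as
  \<sigma> grows, whereas the smoothed distance never falls below the distance between the means of
  P_n and P, which adding noise does not change. For d = 1 the same conflict appears as \<sigma>
  tends to 0. Outside dimension 2 no constant can therefore be uniform in \<sigma>: the bound is
  proved under \<sigma>^(1 - d/2) >= c, with a constant that also depends on \<open>c\<close>.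
  Dimension 2 is the threshold because the side 2^-k of a level competes with sqrt(2^(k d)), the
  price of Cauchy-Schwarz over its cubes. For d <= 2 the side compensates alone; for d >= 3 the
  product grows with k until the noise, acting below scale \<sigma>, makes the probability of
  hitting a small cube small. The factors M_j arise from the last, unrestricted round, where a point
  is moved over a distance comparable to its norm.\<close>

lemma nn_integral_partition:
  fixes q :: "'a \<Rightarrow> 'c::countable"
  assumes [measurable]: "f \<in> borel_measurable M" "q \<in> M \<rightarrow>\<^sub>M count_space UNIV"
  shows "(\<integral>\<^sup>+x. f x \<partial>M)
    = (\<integral>\<^sup>+c. (\<integral>\<^sup>+x. f x * indicator {c} (q x) \<partial>M) \<partial>count_space UNIV)"
proof -
  have "(\<integral>\<^sup>+x. f x \<partial>M) = (\<integral>\<^sup>+x. (\<integral>\<^sup>+c. f x * indicator {c} (q x) \<partial>count_space UNIV) \<partial>M)"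
  proof (intro nn_integral_cong)
    fix x
    have "(\<integral>\<^sup>+c. f x * indicator {c} (q x) \<partial>count_space UNIV)
      = (\<integral>\<^sup>+c. f x * indicator {q x} c \<partial>count_space UNIV)"
      by (intro nn_integral_cong) (auto split: split_indicator)
    also have "\<dots> = f x"
      by (subst nn_integral_cmult_indicator) auto
    finally show "f x = (\<integral>\<^sup>+c. f x * indicator {c} (q x) \<partial>count_space UNIV)" ..
  qed
  also have "\<dots> = (\<integral>\<^sup>+c. (\<integral>\<^sup>+x. f x * indicator {c} (q x) \<partial>M) \<partial>count_space UNIV)"
    by (intro nn_integral_count_space_nn_integral) auto
  finally show ?thesis .
qed

context pair_prob_space
begin

text \<open>
  A partial coupling is represented by its density \<open>h\<close> with respect to the product measure.
  The parts of \<open>M1\<close> and \<open>M2\<close> that it leaves unmatched have the densities \<open>left_rest h\<close> and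
  \<open>right_rest h\<close>, so coupling in several rounds amounts to adding densities.
\<close>

definition subcoupling :: "('a \<times> 'b \<Rightarrow> ennreal) \<Rightarrow> bool" where
  "subcoupling h \<longleftrightarrow> h \<in> borel_measurable (M1 \<Otimes>\<^sub>M M2) \<and>
     (\<forall>x\<in>space M1. (\<integral>\<^sup>+y. h (x, y) \<partial>M2) \<le> 1) \<and> (\<forall>y\<in>space M2. (\<integral>\<^sup>+x. h (x, y) \<partial>M1) \<le> 1)"

definition left_rest :: "('a \<times> 'b \<Rightarrow> ennreal) \<Rightarrow> 'a \<Rightarrow> ennreal" where
  "left_rest h x = 1 - (\<integral>\<^sup>+y. h (x, y) \<partial>M2)"

definition right_rest :: "('a \<times> 'b \<Rightarrow> ennreal) \<Rightarrow> 'b \<Rightarrow> ennreal" where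
  "right_rest h y = 1 - (\<integral>\<^sup>+x. h (x, y) \<partial>M1)"

lemma subcoupling_measurable: "subcoupling h \<Longrightarrow> h \<in> borel_measurable (M1 \<Otimes>\<^sub>M M2)"
  by (simp add: subcoupling_def)

lemma borel_measurable_left_rest:
  assumes "subcoupling h" shows "left_rest h \<in> borel_measurable M1"
proof -
  note [measurable] = subcoupling_measurable[OF assms]
  show ?thesis unfolding left_rest_def by measurable
qed

lemma borel_measurable_right_rest:
  assumes "subcoupling h" shows "right_rest h \<in> borel_measurable M2"
proof -
  note [measurable] = subcoupling_measurable[OF assms]
  have "(\<lambda>(y, x). h (x, y)) \<in> borel_measurable (M2 \<Otimes>\<^sub>M M1)"
    by measurable
  from M1.borel_measurable_nn_integral_fst[OF this] 
  have [measurable]: "(\<lambda>y. \<integral>\<^sup>+x. h (x, y) \<partial>M1) \<in> borel_measurable M2"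
    by simp
  show ?thesis unfolding right_rest_def by measurable
qed

lemma left_rest_le: "left_rest h x \<le> 1"
  by (simp add: left_rest_def diff_le_self_ennreal)

lemma right_rest_le: "right_rest h y \<le> 1"
  by (simp add: right_rest_def diff_le_self_ennreal)

lemma left_rest_add:
  "subcoupling h \<Longrightarrow> x \<in> space M1 \<Longrightarrow> left_rest h x + (\<integral>\<^sup>+y. h (x, y) \<partial>M2) = 1"
  by (simp add: left_rest_def subcoupling_def diff_add_cancel_ennreal)

lemma right_rest_add:
  "subcoupling h \<Longrightarrow> y \<in> space M2 \<Longrightarrow> right_rest h y + (\<integral>\<^sup>+x. h (x, y) \<partial>M1) = 1"
  by (simp add: right_rest_def subcoupling_def diff_add_cancel_ennreal)

lemma left_rest_balance:
  assumes h: "subcoupling h" and A[measurable]: "A \<in> sets M1"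
  shows "(\<integral>\<^sup>+x. left_rest h x * indicator A x \<partial>M1)
    + (\<integral>\<^sup>+z. h z * indicator A (fst z) \<partial>(M1 \<Otimes>\<^sub>M M2)) = emeasure M1 A"
proof -
  note [measurable] = subcoupling_measurable[OF h] borel_measurable_left_rest[OF h]
  have "(\<integral>\<^sup>+z. h z * indicator A (fst z) \<partial>(M1 \<Otimes>\<^sub>M M2))
    = (\<integral>\<^sup>+x. (\<integral>\<^sup>+y. h (x, y) \<partial>M2) * indicator A x \<partial>M1)"
    by (subst M2.nn_integral_fst[symmetric])
      (auto intro!: nn_integral_cong simp: nn_integral_multc)
  then have "(\<integral>\<^sup>+x. left_rest h x * indicator A x \<partial>M1)
      + (\<integral>\<^sup>+z. h z * indicator A (fst z) \<partial>(M1 \<Otimes>\<^sub>M M2))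
    = (\<integral>\<^sup>+x. left_rest h x * indicator A x + (\<integral>\<^sup>+y. h (x, y) \<partial>M2) * indicator A x \<partial>M1)"
    by (simp add: nn_integral_add)
  also have "\<dots> = (\<integral>\<^sup>+x. indicator A x \<partial>M1)"
    using left_rest_add[OF h] by (intro nn_integral_cong) (auto simp flip: distrib_right)
  finally show ?thesis by simp
qed

lemma right_rest_balance:
  assumes h: "subcoupling h" and A[measurable]: "A \<in> sets M2"
  shows "(\<integral>\<^sup>+y. right_rest h y * indicator A y \<partial>M2)
    + (\<integral>\<^sup>+z. h z * indicator A (snd z) \<partial>(M1 \<Otimes>\<^sub>M M2)) = emeasure M2 A"
proof -
  note [measurable] = subcoupling_measurable[OF h] borel_measurable_right_rest[OF h]
  have *: "(\<lambda>(y, x). h (x, y)) \<in> borel_measurable (M2 \<Otimes>\<^sub>M M1)"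
    by measurable
  have [measurable]: "(\<lambda>y. \<integral>\<^sup>+x. h (x, y) \<partial>M1) \<in> borel_measurable M2"
    using M1.borel_measurable_nn_integral_fst[OF *] by simp
  have "(\<integral>\<^sup>+z. h z * indicator A (snd z) \<partial>(M1 \<Otimes>\<^sub>M M2))
    = (\<integral>\<^sup>+y. (\<integral>\<^sup>+x. h (x, y) \<partial>M1) * indicator A y \<partial>M2)"
    by (subst nn_integral_snd[symmetric])
      (auto intro!: nn_integral_cong simp: nn_integral_multc case_prod_beta')
  then have "(\<integral>\<^sup>+y. right_rest h y * indicator A y \<partial>M2)
      + (\<integral>\<^sup>+z. h z * indicator A (snd z) \<partial>(M1 \<Otimes>\<^sub>M M2))
    = (\<integral>\<^sup>+y. right_rest h y * indicator A y + (\<integral>\<^sup>+x. h (x, y) \<partial>M1) * indicator A y \<partial>M2)"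
    by (simp add: nn_integral_add)
  also have "\<dots> = (\<integral>\<^sup>+x. indicator A x \<partial>M2)"
    using right_rest_add[OF h] by (intro nn_integral_cong) (auto simp flip: distrib_right)
  finally show ?thesis by simp
qed

definition exhausts :: "('a \<times> 'b \<Rightarrow> ennreal) \<Rightarrow> ('a \<Rightarrow> 'c) \<Rightarrow> ('b \<Rightarrow> 'c) \<Rightarrow> 'c \<Rightarrow> bool" where
  "exhausts h q1 q2 c \<longleftrightarrow> (\<integral>\<^sup>+x. left_rest h x * indicator {c} (q1 x) \<partial>M1) = 0 \<or>
     (\<integral>\<^sup>+y. right_rest h y * indicator {c} (q2 y) \<partial>M2) = 0"

text \<open>
  In every cell \<open>c\<close> the remaining masses \<open>m c\<close> and \<open>n c\<close> are matched by a multiple of the product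
  measure, scaled so that the smaller one is used up. On cells with \<open>m c = n c = 0\<close> the quotient
  below is \<open>0 / 0 = 0\<close>, as needed.
\<close>

lemma greedy_extension:
  fixes q1 :: "'a \<Rightarrow> 'c::countable"
  assumes h: "subcoupling h"
    and q1[measurable]: "q1 \<in> M1 \<rightarrow>\<^sub>M count_space UNIV"
    and q2[measurable]: "q2 \<in> M2 \<rightarrow>\<^sub>M count_space UNIV"
  obtains g where "g \<in> borel_measurable (M1 \<Otimes>\<^sub>M M2)" "subcoupling (\<lambda>z. h z + g z)"
    "\<And>x y. g (x, y) \<noteq> 0 \<Longrightarrow> q1 x = q2 y"
    "\<And>c. exhausts (\<lambda>z. h z + g z) q1 q2 c"
    "\<And>x. x \<in> space M1 \<Longrightarrow> (\<integral>\<^sup>+y. g (x, y) \<partial>M2) \<le> left_rest h x"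
    "\<And>y. y \<in> space M2 \<Longrightarrow> (\<integral>\<^sup>+x. g (x, y) \<partial>M1) \<le> right_rest h y"
proof -
  note [measurable] = subcoupling_measurable[OF h]
  define a b where "a = left_rest h" and "b = right_rest h"
  note [measurable] = borel_measurable_left_rest[OF h, folded a_def] borel_measurable_right_rest[OF h, folded b_def]
  define m n where "m c = (\<integral>\<^sup>+x. a x * indicator {c} (q1 x) \<partial>M1)"
    and "n c = (\<integral>\<^sup>+y. b y * indicator {c} (q2 y) \<partial>M2)" for c
  have m1: "m c \<le> 1" for c
  proof -
    have "m c \<le> (\<integral>\<^sup>+x. 1 \<partial>M1)" unfolding m_def
      by (intro nn_integral_mono) (auto simp: a_def left_rest_le split: split_indicator)
    then show ?thesis by (simp add: M1.emeasure_space_1)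
  qed
  have n1: "n c \<le> 1" for c
  proof -
    have "n c \<le> (\<integral>\<^sup>+x. 1 \<partial>M2)" unfolding n_def
      by (intro nn_integral_mono) (auto simp: b_def right_rest_le split: split_indicator)
    then show ?thesis by (simp add: M2.emeasure_space_1)
  qed
  \<comment> \<open>Dividing by the larger mass keeps the marginals of \<open>g\<close> below
    \<open>a\<close> and \<open>b\<close>, with equality throughout the cell on the side whose mass
    is smaller.\<close>
  define k where "k c = max (m c) (n c)" for c
  have k1: "k c \<le> 1" for c using m1 n1 by (simp add: k_def)
  define g where "g = (\<lambda>(x, y). a x * b y * indicator {q1 x} (q2 y) / k (q1 x))"
  have [measurable]: "(\<lambda>x. k (q1 x)) \<in> borel_measurable M1" "(\<lambda>y. k (q2 y)) \<in> borel_measurable M2"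
    by (auto intro!: measurable_compose[OF q1] measurable_compose[OF q2])
  have ind: "indicator {q1 x} (q2 y) = (if q1 x = q2 y then 1 else 0 :: ennreal)" for x y
    by (auto split: split_indicator)
  have [measurable]: "Measurable.pred (M1 \<Otimes>\<^sub>M M2) (\<lambda>z. q1 (fst z) = q2 (snd z))"
    by measurable
  have g[measurable]: "g \<in> borel_measurable (M1 \<Otimes>\<^sub>M M2)"
    unfolding g_def ind case_prod_beta' by measurable
  have ga: "(\<integral>\<^sup>+y. g (x, y) \<partial>M2) = a x * (n (q1 x) / k (q1 x))" for x
  proof -
    have "(\<integral>\<^sup>+y. g (x, y) \<partial>M2) = (\<integral>\<^sup>+y. a x / k (q1 x) * (b y * indicator {q1 x} (q2 y)) \<partial>M2)"
      by (intro nn_integral_cong) (simp add: g_def divide_ennreal_def ac_simps)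
    also have "\<dots> = a x / k (q1 x) * n (q1 x)"
      unfolding n_def by (intro nn_integral_cmult) measurable
    finally show ?thesis by (simp add: divide_ennreal_def ac_simps)
  qed
  have gb: "(\<integral>\<^sup>+x. g (x, y) \<partial>M1) = b y * (m (q2 y) / k (q2 y))" for y
  proof -
    have "(\<integral>\<^sup>+x. g (x, y) \<partial>M1) = (\<integral>\<^sup>+x. b y / k (q2 y) * (a x * indicator {q2 y} (q1 x)) \<partial>M1)"
      by (intro nn_integral_cong) (auto simp add: g_def divide_ennreal_def ac_simps split: split_indicator)
    also have "\<dots> = b y / k (q2 y) * m (q2 y)"
      unfolding m_def by (intro nn_integral_cmult) measurable
    finally show ?thesis by (simp add: divide_ennreal_def ac_simps)
  qed
  have one: "u / u = 1" if "u \<noteq> 0" "u \<le> 1" for u :: ennreal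
    using that by (intro ennreal_divide_self) (auto simp: top_unique less_top[symmetric])
  have r: "n c / k c \<le> 1" "m c / k c \<le> 1" for c
  proof -
    have "u / k c \<le> 1" if "u \<le> k c" for u
    proof (cases "k c = 0")
      case False
      then show ?thesis
        using divide_right_mono_ennreal[OF that, of "k c"] one[OF _ k1] by simp
    qed (use that in simp)
    then show "n c / k c \<le> 1" "m c / k c \<le> 1" by (auto simp: k_def)
  qed
  have ga': "(\<integral>\<^sup>+y. g (x, y) \<partial>M2) \<le> a x" for x
    unfolding ga using mult_left_mono[OF r(1)[of "q1 x"], of "a x"] by simp
  have gb': "(\<integral>\<^sup>+x. g (x, y) \<partial>M1) \<le> b y" for y
    unfolding gb using mult_left_mono[OF r(2)[of "q2 y"], of "b y"] by simp
  have sumL: "(\<integral>\<^sup>+y. h (x, y) + g (x, y) \<partial>M2) = (\<integral>\<^sup>+y. h (x, y) \<partial>M2) + (\<integral>\<^sup>+y. g (x, y) \<partial>M2)"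
    if "x \<in> space M1" for x using that by (intro nn_integral_add) measurable
  have sumR: "(\<integral>\<^sup>+x. h (x, y) + g (x, y) \<partial>M1) = (\<integral>\<^sup>+x. h (x, y) \<partial>M1) + (\<integral>\<^sup>+x. g (x, y) \<partial>M1)"
    if "y \<in> space M2" for y using that by (intro nn_integral_add) measurable
  have sc: "subcoupling (\<lambda>z. h z + g z)"
    unfolding subcoupling_def
  proof (intro conjI ballI)
    fix x assume x: "x \<in> space M1"
    show "(\<integral>\<^sup>+y. h (x, y) + g (x, y) \<partial>M2) \<le> 1"
      unfolding sumL[OF x] left_rest_add[OF h x, symmetric]
      using ga'[of x] by (subst add.commute) (auto simp: a_def intro: add_mono)
  next
    fix y assume y: "y \<in> space M2"
    show "(\<integral>\<^sup>+x. h (x, y) + g (x, y) \<partial>M1) \<le> 1"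
      unfolding sumR[OF y] right_rest_add[OF h y, symmetric]
      using gb'[of y] by (subst add.commute) (auto simp: b_def intro: add_mono)
  qed measurable
  have restL: "left_rest (\<lambda>z. h z + g z) x = a x - (\<integral>\<^sup>+y. g (x, y) \<partial>M2)" if "x \<in> space M1" for x
    using that unfolding left_rest_def a_def by (simp add: sumL diff_add_eq_diff_diff_swap_ennreal)
  have restR: "right_rest (\<lambda>z. h z + g z) y = b y - (\<integral>\<^sup>+x. g (x, y) \<partial>M1)" if "y \<in> space M2" for y
    using that unfolding right_rest_def b_def by (simp add: sumR diff_add_eq_diff_diff_swap_ennreal)
  \<comment> \<open>In \<open>ennreal\<close>, \<open>top - top = top\<close>, so this cancellation
    rests on both rests being at most 1.\<close>
  have fin: "a x - a x = 0" "b y - b y = 0" for x y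
    using left_rest_le[of h x] right_rest_le[of h y]
    by (auto intro!: ennreal_diff_self simp: a_def b_def top_unique)
  show ?thesis
  proof (rule that[OF g sc])
    fix c
    consider "m c = 0" | "m c \<noteq> 0" "m c \<le> n c" | "n c < m c" by force
    then show "exhausts (\<lambda>z. h z + g z) q1 q2 c"
    proof cases
      case 1
      \<comment> \<open>A side that is already used up stays so, because adding \<open>g\<close>
        only lowers the rests.\<close>
      have "(\<integral>\<^sup>+x. left_rest (\<lambda>z. h z + g z) x * indicator {c} (q1 x) \<partial>M1) \<le> m c"
        unfolding m_def by (intro nn_integral_mono mult_right_mono) (auto simp: restL diff_le_self_ennreal)
      with 1 show ?thesis by (auto simp: exhausts_def)
    next
      case 2
      then have "n c \<noteq> 0" by (metis le_zero_eq)
      with 2 have "n c / k c = 1" using one[OF _ n1[of c]] by (simp add: k_def max_def)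
      then have "(\<integral>\<^sup>+x. left_rest (\<lambda>z. h z + g z) x * indicator {c} (q1 x) \<partial>M1) = (\<integral>\<^sup>+x. 0 \<partial>M1)"
        by (intro nn_integral_cong) (auto simp: restL ga fin split: split_indicator)
      then show ?thesis by (simp add: exhausts_def)
    next
      case 3
      then have "m c \<noteq> 0" by auto
      with 3 have "m c / k c = 1" using one[OF _ m1[of c]] by (simp add: k_def max_def)
      then have "(\<integral>\<^sup>+y. right_rest (\<lambda>z. h z + g z) y * indicator {c} (q2 y) \<partial>M2) = (\<integral>\<^sup>+x. 0 \<partial>M2)"
        by (intro nn_integral_cong) (auto simp: restR gb fin split: split_indicator)
      then show ?thesis by (simp add: exhausts_def)
    qed
  qed (use ga' gb' in \<open>auto simp: g_def a_def b_def split: split_indicator_asm\<close>)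
qed

text \<open>
  A partial coupling that only matches points within a cell and exhausts one of the two measures
  there leaves over exactly the difference of their masses, whatever it did before.
\<close>

definition mass_gap :: "('a \<Rightarrow> 'c) \<Rightarrow> ('b \<Rightarrow> 'c) \<Rightarrow> 'c \<Rightarrow> ennreal" where
  "mass_gap q1 q2 c =
     ennreal \<bar>measure M1 (q1 -` {c} \<inter> space M1) - measure M2 (q2 -` {c} \<inter> space M2)\<bar>"

lemma rest_le_mass_gap:
  fixes q1 :: "'a \<Rightarrow> 'c::countable"
  assumes h: "subcoupling h" and supp: "\<And>x y. h (x, y) \<noteq> 0 \<Longrightarrow> q1 x = q2 y"
    and ex: "exhausts h q1 q2 c"
    and [measurable]: "q1 \<in> M1 \<rightarrow>\<^sub>M count_space UNIV" "q2 \<in> M2 \<rightarrow>\<^sub>M count_space UNIV"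
  shows "(\<integral>\<^sup>+x. left_rest h x * indicator {c} (q1 x) \<partial>M1) \<le> mass_gap q1 q2 c" (is "?L \<le> _")
    and "(\<integral>\<^sup>+y. right_rest h y * indicator {c} (q2 y) \<partial>M2) \<le> mass_gap q1 q2 c" (is "?R \<le> _")
proof -
  let ?A = "q1 -` {c} \<inter> space M1" and ?B = "q2 -` {c} \<inter> space M2"
  \<comment> \<open>The mass already matched in the cell. Since \<open>h\<close> pairs only points
    of equal cells, it is the same seen from \<open>M1\<close> and from \<open>M2\<close>. If the
    right side is exhausted, \<open>J\<close> is all of the \<open>M2\<close> mass of the cell and
    the left rest is the difference; otherwise the left rest is 0.\<close>
  define J where "J = (\<integral>\<^sup>+z. h z * indicator ?A (fst z) \<partial>(M1 \<Otimes>\<^sub>M M2))"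
  have A: "?A \<in> sets M1" and B: "?B \<in> sets M2" by measurable
  have J': "J = (\<integral>\<^sup>+z. h z * indicator ?B (snd z) \<partial>(M1 \<Otimes>\<^sub>M M2))"
    unfolding J_def
  proof (intro nn_integral_cong)
    fix z assume "z \<in> space (M1 \<Otimes>\<^sub>M M2)"
    then show "h z * indicator ?A (fst z) = h z * indicator ?B (snd z)"
      using supp[of "fst z" "snd z"]
      by (cases "h z = 0") (auto simp: space_pair_measure split: split_indicator)
  qed
  have "?L = (\<integral>\<^sup>+x. left_rest h x * indicator ?A x \<partial>M1)"
    by (intro nn_integral_cong) (auto split: split_indicator)
  with left_rest_balance[OF h A] have L: "?L + J = ennreal (measure M1 ?A)"
    by (simp add: J_def M1.emeasure_eq_measure)
  have "?R = (\<integral>\<^sup>+x. right_rest h x * indicator ?B x \<partial>M2)"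
    by (intro nn_integral_cong) (auto split: split_indicator)
  with right_rest_balance[OF h B] have R: "?R + J = ennreal (measure M2 ?B)"
    by (simp add: J' M2.emeasure_eq_measure)
  from L R have J: "J \<noteq> top" by auto
  have "?L = ?L + J - J" "?R = ?R + J - J"
    using J by simp_all
  with L R have L': "?L = ennreal (measure M1 ?A) - J" and R': "?R = ennreal (measure M2 ?B) - J"
    by auto
  show "?L \<le> mass_gap q1 q2 c"
  proof (cases "?R = 0")
    case True
    with L' R show ?thesis by (simp add: mass_gap_def ennreal_minus ennreal_leI)
  qed (use ex in \<open>auto simp: exhausts_def\<close>)
  show "?R \<le> mass_gap q1 q2 c"
  proof (cases "?L = 0")
    case True
    with R' L show ?thesis by (simp add: mass_gap_def ennreal_minus ennreal_leI)
  qed (use ex in \<open>auto simp: exhausts_def\<close>)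
qed

text \<open>A weight that is constant on cells can be pulled out of the bound for each cell. Weight
  1 gives the mass handed to the next level; a weight controlling the distance gives the cost of the
  last round.\<close>

lemma sum_rest_le_mass_gap:
  fixes q1 :: "'a \<Rightarrow> 'c::countable" and w :: "'c \<Rightarrow> ennreal"
  assumes h: "subcoupling h" and supp: "\<And>x y. h (x, y) \<noteq> 0 \<Longrightarrow> q1 x = q2 y"
    and ex: "\<And>c. exhausts h q1 q2 c"
    and q1[measurable]: "q1 \<in> M1 \<rightarrow>\<^sub>M count_space UNIV"
    and q2[measurable]: "q2 \<in> M2 \<rightarrow>\<^sub>M count_space UNIV"
  shows "(\<integral>\<^sup>+x. left_rest h x * w (q1 x) \<partial>M1) \<le> (\<integral>\<^sup>+c. w c * mass_gap q1 q2 c \<partial>count_space UNIV)"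
    and "(\<integral>\<^sup>+y. right_rest h y * w (q2 y) \<partial>M2) \<le> (\<integral>\<^sup>+c. w c * mass_gap q1 q2 c \<partial>count_space UNIV)"
proof -
  note [measurable] = borel_measurable_left_rest[OF h] borel_measurable_right_rest[OF h]
  have [measurable]: "(\<lambda>x. w (q1 x)) \<in> borel_measurable M1" "(\<lambda>y. w (q2 y)) \<in> borel_measurable M2"
    by (auto intro!: measurable_compose[OF q1] measurable_compose[OF q2])
  have "(\<integral>\<^sup>+x. left_rest h x * w (q1 x) \<partial>M1)
    = (\<integral>\<^sup>+c. (\<integral>\<^sup>+x. left_rest h x * w (q1 x) * indicator {c} (q1 x) \<partial>M1) \<partial>count_space UNIV)"
    by (rule nn_integral_partition) measurable
  also have "\<dots> = (\<integral>\<^sup>+c. w c * (\<integral>\<^sup>+x. left_rest h x * indicator {c} (q1 x) \<partial>M1) \<partial>count_space UNIV)"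
    by (subst nn_integral_cmult[symmetric], measurable)
      (auto intro!: nn_integral_cong simp: ac_simps split: split_indicator)
  also have "\<dots> \<le> (\<integral>\<^sup>+c. w c * mass_gap q1 q2 c \<partial>count_space UNIV)"
    using rest_le_mass_gap(1)[OF h supp ex q1 q2]
    by (intro nn_integral_mono mult_left_mono) auto
  finally show "(\<integral>\<^sup>+x. left_rest h x * w (q1 x) \<partial>M1) \<le> \<dots>" .
  have "(\<integral>\<^sup>+x. right_rest h x * w (q2 x) \<partial>M2)
    = (\<integral>\<^sup>+c. (\<integral>\<^sup>+x. right_rest h x * w (q2 x) * indicator {c} (q2 x) \<partial>M2) \<partial>count_space UNIV)"
    by (rule nn_integral_partition) measurable
  also have "\<dots> = (\<integral>\<^sup>+c. w c * (\<integral>\<^sup>+x. right_rest h x * indicator {c} (q2 x) \<partial>M2) \<partial>count_space UNIV)"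
    by (subst nn_integral_cmult[symmetric], measurable)
      (auto intro!: nn_integral_cong simp: ac_simps split: split_indicator)
  also have "\<dots> \<le> (\<integral>\<^sup>+c. w c * mass_gap q1 q2 c \<partial>count_space UNIV)"
    using rest_le_mass_gap(2)[OF h supp ex q1 q2]
    by (intro nn_integral_mono mult_left_mono) auto
  finally show "(\<integral>\<^sup>+x. right_rest h x * w (q2 x) \<partial>M2) \<le> \<dots>" .
qed

section \<open>Coupling on several scales in succession\<close>

lemma extension_cost:
  assumes h: "subcoupling h"
    and g[measurable]: "g \<in> borel_measurable (M1 \<Otimes>\<^sub>M M2)"
    and D: "\<And>x y. g (x, y) \<noteq> 0 \<Longrightarrow> D (x, y) \<le> \<delta>"
    and le: "\<And>x. x \<in> space M1 \<Longrightarrow> (\<integral>\<^sup>+y. g (x, y) \<partial>M2) \<le> left_rest h x"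
  shows "(\<integral>\<^sup>+z. g z * D z \<partial>(M1 \<Otimes>\<^sub>M M2)) \<le> \<delta> * (\<integral>\<^sup>+x. left_rest h x \<partial>M1)"
proof -
  have "(\<integral>\<^sup>+z. g z * D z \<partial>(M1 \<Otimes>\<^sub>M M2)) \<le> (\<integral>\<^sup>+z. \<delta> * g z \<partial>(M1 \<Otimes>\<^sub>M M2))"
  proof (intro nn_integral_mono)
    fix z show "g z * D z \<le> \<delta> * g z"
      using D[of "fst z" "snd z"] mult_left_mono[of "D z" \<delta> "g z"]
      by (cases "g z = 0") (auto simp: mult.commute)
  qed
  also have "\<dots> = \<delta> * (\<integral>\<^sup>+x. \<integral>\<^sup>+y. g (x, y) \<partial>M2 \<partial>M1)"
    by (simp add: nn_integral_cmult M2.nn_integral_fst)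
  also have "\<dots> \<le> \<delta> * (\<integral>\<^sup>+x. left_rest h x \<partial>M1)"
    using le by (intro mult_left_mono nn_integral_mono) auto
  finally show ?thesis .
qed

lemma subcoupling_zero: "subcoupling (\<lambda>_. 0)"
  by (simp add: subcoupling_def)

text \<open>The induction runs down from the finest level \<open>m\<close>, where nothing is matched
  yet and the total mass 1 gives the term \<open>\<delta> m\<close>. What enters level
  \<open>k\<close> is the rest of level \<open>Suc k\<close>, bounded by the gaps there; hence the
  shift between the index of \<delta> and that of the gaps. By \<open>coarser\<close>, pairs matched
  earlier still lie in a common cell of level \<open>k\<close>, so its rest is again controlled by
  its gaps alone.\<close>

lemma multiscale_subcoupling:
  fixes q1 :: "nat \<Rightarrow> 'a \<Rightarrow> 'c::countable" and D :: "'a \<times> 'b \<Rightarrow> ennreal"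
  assumes q1[measurable]: "\<And>k. q1 k \<in> M1 \<rightarrow>\<^sub>M count_space UNIV"
    and q2[measurable]: "\<And>k. q2 k \<in> M2 \<rightarrow>\<^sub>M count_space UNIV"
    and coarser: "\<And>k x y. q1 (Suc k) x = q2 (Suc k) y \<Longrightarrow> q1 k x = q2 k y"
    and D[measurable]: "D \<in> borel_measurable (M1 \<Otimes>\<^sub>M M2)"
    and \<delta>: "\<And>k x y. q1 k x = q2 k y \<Longrightarrow> D (x, y) \<le> \<delta> k"
    and "k \<le> m"
  shows "\<exists>h. subcoupling h \<and> (\<forall>x y. h (x, y) \<noteq> 0 \<longrightarrow> q1 k x = q2 k y) \<and>
    (\<forall>c. exhausts h (q1 k) (q2 k) c) \<and>
    (\<integral>\<^sup>+z. h z * D z \<partial>(M1 \<Otimes>\<^sub>M M2))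
      \<le> \<delta> m + (\<Sum>i\<in>{k..<m}. \<delta> i * (\<integral>\<^sup>+c. mass_gap (q1 (Suc i)) (q2 (Suc i)) c \<partial>count_space UNIV))"
  using \<open>k \<le> m\<close>
proof (induction rule: inc_induct)
  case base
  obtain g where g: "g \<in> borel_measurable (M1 \<Otimes>\<^sub>M M2)" "subcoupling (\<lambda>z. 0 + g z)"
    "\<And>x y. g (x, y) \<noteq> 0 \<Longrightarrow> q1 m x = q2 m y"
    "\<And>c. exhausts (\<lambda>z. 0 + g z) (q1 m) (q2 m) c"
    "\<And>x. x \<in> space M1 \<Longrightarrow> (\<integral>\<^sup>+y. g (x, y) \<partial>M2) \<le> left_rest (\<lambda>_. 0) x"
    "\<And>y. y \<in> space M2 \<Longrightarrow> (\<integral>\<^sup>+x. g (x, y) \<partial>M1) \<le> right_rest (\<lambda>_. 0) y"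
    by (rule greedy_extension[OF subcoupling_zero q1 q2, of m m]) (rule that)
  have "(\<integral>\<^sup>+z. g z * D z \<partial>(M1 \<Otimes>\<^sub>M M2)) \<le> \<delta> m * (\<integral>\<^sup>+x. left_rest (\<lambda>_. 0) x \<partial>M1)"
    using \<delta>[OF g(3)] by (intro extension_cost subcoupling_zero g) auto
  also have "\<dots> = \<delta> m"
    by (simp add: left_rest_def M1.emeasure_space_1)
  finally show ?case
    using g(2-4) by (intro exI[of _ g]) simp
next
  case (step k)
  then obtain h where h: "subcoupling h" "\<And>x y. h (x, y) \<noteq> 0 \<Longrightarrow> q1 (Suc k) x = q2 (Suc k) y"
    "\<And>c. exhausts h (q1 (Suc k)) (q2 (Suc k)) c"
    and cost: "(\<integral>\<^sup>+z. h z * D z \<partial>(M1 \<Otimes>\<^sub>M M2))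
      \<le> \<delta> m + (\<Sum>i\<in>{Suc k..<m}. \<delta> i * (\<integral>\<^sup>+c. mass_gap (q1 (Suc i)) (q2 (Suc i)) c \<partial>count_space UNIV))"
    by auto
  obtain g where g[measurable]: "g \<in> borel_measurable (M1 \<Otimes>\<^sub>M M2)" and g': "subcoupling (\<lambda>z. h z + g z)"
    "\<And>x y. g (x, y) \<noteq> 0 \<Longrightarrow> q1 k x = q2 k y"
    "\<And>c. exhausts (\<lambda>z. h z + g z) (q1 k) (q2 k) c"
    "\<And>x. x \<in> space M1 \<Longrightarrow> (\<integral>\<^sup>+y. g (x, y) \<partial>M2) \<le> left_rest h x"
    "\<And>y. y \<in> space M2 \<Longrightarrow> (\<integral>\<^sup>+x. g (x, y) \<partial>M1) \<le> right_rest h y"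
    by (rule greedy_extension[OF h(1) q1 q2, of k k]) (rule that)
  note [measurable] = subcoupling_measurable[OF h(1)]
  have "(\<integral>\<^sup>+z. g z * D z \<partial>(M1 \<Otimes>\<^sub>M M2)) \<le> \<delta> k * (\<integral>\<^sup>+x. left_rest h x \<partial>M1)"
    using \<delta>[OF g'(2)] by (intro extension_cost h g g') auto
  also have "\<dots> \<le> \<delta> k * (\<integral>\<^sup>+c. mass_gap (q1 (Suc k)) (q2 (Suc k)) c \<partial>count_space UNIV)"
    using sum_rest_le_mass_gap(1)[OF h q1 q2, of "\<lambda>_. 1"] by (intro mult_left_mono) auto
  finally have gcost: "(\<integral>\<^sup>+z. g z * D z \<partial>(M1 \<Otimes>\<^sub>M M2)) \<le> \<dots>" .
  have "(\<integral>\<^sup>+z. (h z + g z) * D z \<partial>(M1 \<Otimes>\<^sub>M M2))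
      = (\<integral>\<^sup>+z. h z * D z \<partial>(M1 \<Otimes>\<^sub>M M2)) + (\<integral>\<^sup>+z. g z * D z \<partial>(M1 \<Otimes>\<^sub>M M2))"
    by (simp add: distrib_right nn_integral_add)
  also note add_mono[OF cost gcost]
  finally have "(\<integral>\<^sup>+z. (h z + g z) * D z \<partial>(M1 \<Otimes>\<^sub>M M2)) \<le>
    \<delta> m + (\<Sum>i\<in>{k..<m}. \<delta> i * (\<integral>\<^sup>+c. mass_gap (q1 (Suc i)) (q2 (Suc i)) c \<partial>count_space UNIV))"
    unfolding sum.atLeast_Suc_lessThan[OF \<open>k < m\<close>] by (subst add.left_commute, subst add.commute)
  moreover have "q1 k x = q2 k y" if "h (x, y) + g (x, y) \<noteq> 0" for x y
  proof (cases "g (x, y) = 0")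
    case True
    with that have "h (x, y) \<noteq> 0" by simp
    then show ?thesis by (rule coarser[OF h(2)])
  qed (rule g')
  ultimately show ?case
    using g' by (intro exI[of _ "\<lambda>z. h z + g z"]) blast
qed

lemma subcoupling_in_couplings:
  assumes h: "subcoupling h"
    and L: "(\<integral>\<^sup>+x. left_rest h x \<partial>M1) = 0" and R: "(\<integral>\<^sup>+y. right_rest h y \<partial>M2) = 0"
  shows "density (M1 \<Otimes>\<^sub>M M2) h \<in> couplings M1 M2"
proof -
  note [measurable] = subcoupling_measurable[OF h]
    borel_measurable_left_rest[OF h] borel_measurable_right_rest[OF h]
  have "distr (density (M1 \<Otimes>\<^sub>M M2) h) M1 fst = M1"
  proof (rule measure_eqI)
    fix A assume "A \<in> sets (distr (density (M1 \<Otimes>\<^sub>M M2) h) M1 fst)"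
    then have [measurable]: "A \<in> sets M1" by simp
    have "emeasure (distr (density (M1 \<Otimes>\<^sub>M M2) h) M1 fst) A
      = (\<integral>\<^sup>+z. h z * indicator A (fst z) \<partial>(M1 \<Otimes>\<^sub>M M2))"
      by (simp add: emeasure_distr emeasure_density)
        (auto intro!: nn_integral_cong split: split_indicator)
    moreover have "(\<integral>\<^sup>+x. left_rest h x * indicator A x \<partial>M1) = 0"
    proof -
      have "(\<integral>\<^sup>+x. left_rest h x * indicator A x \<partial>M1) \<le> (\<integral>\<^sup>+x. left_rest h x \<partial>M1)"
        by (intro nn_integral_mono) (auto split: split_indicator)
      with L show ?thesis by simp
    qed
    ultimately show "emeasure (distr (density (M1 \<Otimes>\<^sub>M M2) h) M1 fst) A = emeasure M1 A"
      using left_rest_balance[OF h, of A] by simp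
  qed simp
  moreover have "distr (density (M1 \<Otimes>\<^sub>M M2) h) M2 snd = M2"
  proof (rule measure_eqI)
    fix A assume "A \<in> sets (distr (density (M1 \<Otimes>\<^sub>M M2) h) M2 snd)"
    then have [measurable]: "A \<in> sets M2" by simp
    have "emeasure (distr (density (M1 \<Otimes>\<^sub>M M2) h) M2 snd) A
      = (\<integral>\<^sup>+z. h z * indicator A (snd z) \<partial>(M1 \<Otimes>\<^sub>M M2))"
      by (simp add: emeasure_distr emeasure_density)
        (auto intro!: nn_integral_cong split: split_indicator)
    moreover have "(\<integral>\<^sup>+y. right_rest h y * indicator A y \<partial>M2) = 0"
    proof -
      have "(\<integral>\<^sup>+x. right_rest h x * indicator A x \<partial>M2) \<le> (\<integral>\<^sup>+x. right_rest h x \<partial>M2)"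
        by (intro nn_integral_mono) (auto split: split_indicator)
      with R show ?thesis by simp
    qed
    ultimately show "emeasure (distr (density (M1 \<Otimes>\<^sub>M M2) h) M2 snd) A = emeasure M2 A"
      using right_rest_balance[OF h, of A] by simp
  qed simp
  ultimately show ?thesis
    by (simp add: couplings_def)
qed

lemma multiscale_coupling:
  fixes q1 :: "nat \<Rightarrow> 'a \<Rightarrow> 'c::countable" and D :: "'a \<times> 'b \<Rightarrow> ennreal"
  assumes q1[measurable]: "\<And>k. q1 k \<in> M1 \<rightarrow>\<^sub>M count_space UNIV"
    and q2[measurable]: "\<And>k. q2 k \<in> M2 \<rightarrow>\<^sub>M count_space UNIV"
    and coarser: "\<And>k x y. q1 (Suc k) x = q2 (Suc k) y \<Longrightarrow> q1 k x = q2 k y"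
    and D[measurable]: "D \<in> borel_measurable (M1 \<Otimes>\<^sub>M M2)"
    and \<delta>: "\<And>k x y. q1 k x = q2 k y \<Longrightarrow> D (x, y) \<le> \<delta> k"
    and w: "\<And>x y. D (x, y) \<le> w (q1 0 x) + w (q2 0 y)"
  obtains \<pi> where "\<pi> \<in> couplings M1 M2"
    "(\<integral>\<^sup>+z. D z \<partial>\<pi>) \<le>
      \<delta> m + (\<Sum>i<m. \<delta> i * (\<integral>\<^sup>+c. mass_gap (q1 (Suc i)) (q2 (Suc i)) c \<partial>count_space UNIV))
      + 2 * (\<integral>\<^sup>+c. w c * mass_gap (q1 0) (q2 0) c \<partial>count_space UNIV)"
proof -
  define S where "S = \<delta> m + (\<Sum>i<m. \<delta> i * (\<integral>\<^sup>+c. mass_gap (q1 (Suc i)) (q2 (Suc i)) c \<partial>count_space UNIV))"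
  define T where "T = (\<integral>\<^sup>+c. w c * mass_gap (q1 0) (q2 0) c \<partial>count_space UNIV)"
  obtain h where h: "subcoupling h" "\<And>x y. h (x, y) \<noteq> 0 \<Longrightarrow> q1 0 x = q2 0 y"
    "\<And>c. exhausts h (q1 0) (q2 0) c" and cost: "(\<integral>\<^sup>+z. h z * D z \<partial>(M1 \<Otimes>\<^sub>M M2)) \<le> S"
    using multiscale_subcoupling[of q1 q2 D \<delta> 0 m, OF q1 q2 coarser D \<delta>]
    by (auto simp: S_def atLeast0LessThan)
  \<comment> \<open>The last round has a single cell, indexed by the unit type, so any two points
    may be matched.\<close>
  obtain g where g[measurable]: "g \<in> borel_measurable (M1 \<Otimes>\<^sub>M M2)" and g': "subcoupling (\<lambda>z. h z + g z)"
    "\<And>x y. g (x, y) \<noteq> 0 \<Longrightarrow> () = ()"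
    "\<And>c. exhausts (\<lambda>z. h z + g z) (\<lambda>_. ()) (\<lambda>_. ()) c"
    "\<And>x. x \<in> space M1 \<Longrightarrow> (\<integral>\<^sup>+y. g (x, y) \<partial>M2) \<le> left_rest h x"
    "\<And>y. y \<in> space M2 \<Longrightarrow> (\<integral>\<^sup>+x. g (x, y) \<partial>M1) \<le> right_rest h y"
    by (rule greedy_extension[OF h(1), of "\<lambda>_. ()" "\<lambda>_. ()"], simp, simp) (rule that)
  note [measurable] = subcoupling_measurable[OF h(1)]
    borel_measurable_left_rest[OF h(1)] borel_measurable_right_rest[OF h(1)]
  have [measurable]: "(\<lambda>x. w (q1 0 x)) \<in> borel_measurable M1" "(\<lambda>y. w (q2 0 y)) \<in> borel_measurable M2"
    by (auto intro!: measurable_compose[OF q1] measurable_compose[OF q2])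
  \<comment> \<open>The bound on \<open>D\<close> separates the variables, so each summand sees only
    one marginal of \<open>g\<close>; the two sides contribute \<open>T\<close> each.\<close>
  have "(\<integral>\<^sup>+z. g z * D z \<partial>(M1 \<Otimes>\<^sub>M M2))
    \<le> (\<integral>\<^sup>+z. g z * w (q1 0 (fst z)) + g z * w (q2 0 (snd z)) \<partial>(M1 \<Otimes>\<^sub>M M2))"
    using w by (intro nn_integral_mono) (auto simp flip: distrib_left intro!: mult_left_mono)
  also have "\<dots> = (\<integral>\<^sup>+z. g z * w (q1 0 (fst z)) \<partial>(M1 \<Otimes>\<^sub>M M2))
      + (\<integral>\<^sup>+z. g z * w (q2 0 (snd z)) \<partial>(M1 \<Otimes>\<^sub>M M2))"
    by (intro nn_integral_add) measurable
  also have "(\<integral>\<^sup>+z. g z * w (q1 0 (fst z)) \<partial>(M1 \<Otimes>\<^sub>M M2))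
      = (\<integral>\<^sup>+x. (\<integral>\<^sup>+y. g (x, y) \<partial>M2) * w (q1 0 x) \<partial>M1)"
    by (subst M2.nn_integral_fst[symmetric])
      (auto intro!: nn_integral_cong simp: nn_integral_multc)
  also have "\<dots> \<le> (\<integral>\<^sup>+x. left_rest h x * w (q1 0 x) \<partial>M1)"
    using g'(4) by (intro nn_integral_mono mult_right_mono) auto
  also have "\<dots> \<le> T"
    unfolding T_def by (rule sum_rest_le_mass_gap[OF h q1 q2])
  also have "(\<integral>\<^sup>+z. g z * w (q2 0 (snd z)) \<partial>(M1 \<Otimes>\<^sub>M M2))
      = (\<integral>\<^sup>+y. (\<integral>\<^sup>+x. g (x, y) \<partial>M1) * w (q2 0 y) \<partial>M2)"
    by (subst nn_integral_snd[symmetric])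
      (auto intro!: nn_integral_cong simp: nn_integral_multc case_prod_beta')
  also have "\<dots> \<le> (\<integral>\<^sup>+y. right_rest h y * w (q2 0 y) \<partial>M2)"
    using g'(5) by (intro nn_integral_mono mult_right_mono) auto
  also have "\<dots> \<le> T"
    unfolding T_def by (rule sum_rest_le_mass_gap[OF h q1 q2])
  finally have gcost: "(\<integral>\<^sup>+z. g z * D z \<partial>(M1 \<Otimes>\<^sub>M M2)) \<le> 2 * T"
    by (simp add: mult_2)
  let ?h = "\<lambda>z. h z + g z"
  \<comment> \<open>Both total masses are 1, so the single cell has gap 0 and no rest survives: the
    density now defines a full coupling.\<close>
  have "mass_gap (\<lambda>_. ()) (\<lambda>_. ()) () = 0"
    by (simp add: mass_gap_def M1.prob_space M2.prob_space)
  moreover have "(\<integral>\<^sup>+x. left_rest ?h x * indicator {()} () \<partial>M1) \<le> mass_gap (\<lambda>_. ()) (\<lambda>_. ()) ()"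
    by (rule rest_le_mass_gap(1)[OF g'(1) _ g'(3)]) simp_all
  moreover have "(\<integral>\<^sup>+y. right_rest ?h y * indicator {()} () \<partial>M2) \<le> mass_gap (\<lambda>_. ()) (\<lambda>_. ()) ()"
    by (rule rest_le_mass_gap(2)[OF g'(1) _ g'(3)]) simp_all
  ultimately have "(\<integral>\<^sup>+x. left_rest ?h x \<partial>M1) = 0" "(\<integral>\<^sup>+y. right_rest ?h y \<partial>M2) = 0"
    by (simp_all only: le_zero_eq indicator_simps insertI1 mult_1_right simp_thms)
  then have "density (M1 \<Otimes>\<^sub>M M2) ?h \<in> couplings M1 M2"
    by (intro subcoupling_in_couplings g')
  moreover have "(\<integral>\<^sup>+z. D z \<partial>density (M1 \<Otimes>\<^sub>M M2) ?h) \<le> S + 2 * T"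
    using add_mono[OF cost gcost]
    by (simp add: nn_integral_density distrib_right nn_integral_add)
  ultimately show ?thesis
    by (intro that) (auto simp: S_def T_def)
qed

end

section \<open>Dyadic cells\<close>

lemma borel_measurable_vec_nth: "(\<lambda>x::real ^ 'n. x $ i) \<in> borel_measurable borel"
  by (intro borel_measurable_continuous_onI continuous_intros)

text \<open>A half-open cube of side 2^-k is named by 2^k times its lower corner, so the cells of
  all levels share one countable index type.\<close>

definition dyadic_cell :: "nat \<Rightarrow> real ^ 'n \<Rightarrow> int ^ 'n" where
  "dyadic_cell k x = (\<chi> i. \<lfloor>2 ^ k * x $ i\<rfloor>)"

lemma dyadic_cell_eq_iff:
  "dyadic_cell k x = c \<longleftrightarrow> (\<forall>i. c $ i \<le> 2 ^ k * x $ i \<and> 2 ^ k * x $ i < c $ i + 1)"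
  by (simp add: dyadic_cell_def vec_eq_iff floor_eq_iff)

lemma measurable_dyadic_cell [measurable]:
  "dyadic_cell k \<in> (borel :: (real ^ 'n) measure) \<rightarrow>\<^sub>M count_space UNIV"
  unfolding measurable_count_space_eq2_countable
proof (intro conjI ballI)
  fix c :: "int ^ 'n"
  have "dyadic_cell k -` {c} \<inter> space borel
    = {x. \<forall>i. c $ i \<le> 2 ^ k * x $ i \<and> 2 ^ k * x $ i < c $ i + 1}"
    by (simp add: set_eq_iff dyadic_cell_eq_iff)
  also have "\<dots> \<in> sets (borel :: (real ^ 'n) measure)"
  proof -
    note [measurable] = borel_measurable_vec_nth
    show ?thesis by measurable
  qed
  finally show "dyadic_cell k -` {c} \<inter> space borel \<in> sets (borel :: (real ^ 'n) measure)" .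
qed simp

lemma dyadic_cell_vimage_borel [measurable]:
  "dyadic_cell k -` {c} \<in> sets (borel :: (real ^ 'n) measure)"
  using measurable_sets[OF measurable_dyadic_cell, of "{c}" k] by simp

lemma dyadic_cell_ancestor:
  "dyadic_cell k x $ i = dyadic_cell (k + l) x $ i div 2 ^ l"
  using floor_divide_real_eq_div[of "2 ^ l" "2 ^ (k + l) * x $ i"]
  by (simp add: dyadic_cell_def power_add)

text \<open>Comparison with the l1 norm; the resulting d in place of sqrt d only affects the
  constant.\<close>

lemma dist_dyadic_cell:
  fixes x y :: "real ^ 'n"
  assumes "dyadic_cell k x = dyadic_cell k y"
  shows "dist x y \<le> CARD('n) / 2 ^ k"
proof -
  have "\<bar>(x - y) $ i\<bar> \<le> 1 / 2 ^ k" for i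
  proof -
    from assms have "\<lfloor>2 ^ k * x $ i\<rfloor> = \<lfloor>2 ^ k * y $ i\<rfloor>"
      by (simp add: dyadic_cell_def vec_eq_iff)
    then have "\<bar>2 ^ k * (x $ i - y $ i)\<bar> < 1"
      unfolding right_diff_distrib by linarith
    then have "2 ^ k * \<bar>x $ i - y $ i\<bar> \<le> 1"
      by (simp add: abs_mult)
    then show ?thesis
      by (simp add: field_simps)
  qed
  then have "(\<Sum>i\<in>UNIV. \<bar>(x - y) $ i\<bar>) \<le> (\<Sum>i\<in>(UNIV::'n set). 1 / 2 ^ k)"
    by (intro sum_mono)
  then show ?thesis
    using norm_le_l1_cart[of "x - y"] by (simp add: dist_norm)
qed

text \<open>An l1 bound for the norm on a unit cell. The 1 added in each coordinate pays for the
  floor, and it also makes the radius at least 1, so that it can be inserted as a weight where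
  needed.\<close>

definition cell_radius :: "int ^ 'n \<Rightarrow> real" where
  "cell_radius c = (\<Sum>i\<in>UNIV. \<bar>real_of_int (c $ i)\<bar> + 1)"

lemma norm_le_cell_radius: "norm x \<le> cell_radius (dyadic_cell 0 x)"
proof -
  have "\<bar>x $ i\<bar> \<le> \<bar>real_of_int (dyadic_cell 0 x $ i)\<bar> + 1" for i
    by (simp add: dyadic_cell_def) linarith
  then show ?thesis
    unfolding cell_radius_def using norm_le_l1_cart[of x]
    by (meson order_trans sum_mono)
qed

lemma cell_radius_nonneg: "0 \<le> cell_radius c"
  by (auto simp: cell_radius_def intro!: sum_nonneg)

definition cell_gap :: "(real ^ 'n) measure \<Rightarrow> (real ^ 'n) measure \<Rightarrow> nat \<Rightarrow> int ^ 'n \<Rightarrow> real" where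
  "cell_gap P Q k c = \<bar>measure P (dyadic_cell k -` {c}) - measure Q (dyadic_cell k -` {c})\<bar>"

lemma wasserstein1_le_cell_gaps:
  fixes P Q :: "(real ^ 'n) measure"
  assumes "prob_space P" "prob_space Q" and sets: "sets P = sets borel" "sets Q = sets borel"
  shows "wasserstein1 P Q \<le> ennreal (CARD('n) / 2 ^ m)
    + (\<Sum>i<m. ennreal (CARD('n) / 2 ^ i) * (\<integral>\<^sup>+c. ennreal (cell_gap P Q (Suc i) c) \<partial>count_space UNIV))
    + 2 * (\<integral>\<^sup>+c. ennreal (cell_radius c) * ennreal (cell_gap P Q 0 c) \<partial>count_space UNIV)"
proof -
  interpret P: prob_space P by fact
  interpret Q: prob_space Q by fact
  interpret PQ: pair_prob_space P Q ..
  note [measurable_cong] = sets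
  have sp: "space P = UNIV" "space Q = UNIV"
    using sets[THEN sets_eq_imp_space_eq] by auto
  have gap: "PQ.mass_gap (dyadic_cell k) (dyadic_cell k) c = ennreal (cell_gap P Q k c)" for k c
    by (simp add: PQ.mass_gap_def cell_gap_def sp)
  have coarser: "dyadic_cell k x = dyadic_cell k y" if "dyadic_cell (Suc k) x = dyadic_cell (Suc k) y"
    for k and x y :: "real ^ 'n"
    using that by (simp add: vec_eq_iff dyadic_cell_ancestor[of k _ _ 1])
  have D: "(\<lambda>(x, y). ennreal (dist x y)) \<in> borel_measurable (P \<Otimes>\<^sub>M Q)"
    by measurable
  have w: "(\<lambda>(x, y). ennreal (dist x y)) (x, y) \<le> ennreal (cell_radius (dyadic_cell 0 x)) + ennreal (cell_radius (dyadic_cell 0 y))"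
    for x y :: "real ^ 'n"
  proof -
    \<comment> \<open>Routing through the origin bounds the distance by a sum of one term for each
      cell, as the last round requires.\<close>
    have "dist x y \<le> norm x + norm y" by (simp add: dist_norm norm_triangle_ineq4)
    also have "\<dots> \<le> cell_radius (dyadic_cell 0 x) + cell_radius (dyadic_cell 0 y)"
      by (intro add_mono norm_le_cell_radius)
    finally show ?thesis by (simp add: cell_radius_nonneg flip: ennreal_plus)
  qed
  obtain \<pi> where "\<pi> \<in> couplings P Q"
    "(\<integral>\<^sup>+z. (\<lambda>(x, y). ennreal (dist x y)) z \<partial>\<pi>) \<le> ennreal (CARD('n) / 2 ^ m)
    + (\<Sum>i<m. ennreal (CARD('n) / 2 ^ i) * (\<integral>\<^sup>+c. PQ.mass_gap (dyadic_cell (Suc i)) (dyadic_cell (Suc i)) c \<partial>count_space UNIV))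
    + 2 * (\<integral>\<^sup>+c. ennreal (cell_radius c) * PQ.mass_gap (dyadic_cell 0) (dyadic_cell 0) c \<partial>count_space UNIV)"
    by (rule PQ.multiscale_coupling[of dyadic_cell dyadic_cell "\<lambda>(x, y). ennreal (dist x y)" "\<lambda>k. ennreal (CARD('n) / 2 ^ k)" "\<lambda>c. ennreal (cell_radius c)" m,
       OF _ _ coarser D _ w])
      (use dist_dyadic_cell in \<open>auto intro!: ennreal_leI\<close>)
  then show ?thesis
    unfolding wasserstein1_def gap by (intro INF_lower2)
qed

lemma one_le_cell_radius: "1 \<le> cell_radius c" for c :: "int ^ 'n"
proof -
  have "(1::real) \<le> CARD('n)" by (simp add: Suc_leI)
  also have "\<dots> = (\<Sum>i\<in>(UNIV::'n set). 1)" by simp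
  also have "\<dots> \<le> cell_radius c"
    unfolding cell_radius_def by (intro sum_mono) simp
  finally show ?thesis .
qed

section \<open>Fluctuations of empirical means\<close>

text \<open>This is the nonnegativity of the variance of the absolute value of
  \<open>Z\<close>.\<close>

lemma (in prob_space) nn_integral_abs_le_sqrt:
  fixes Z :: "'a \<Rightarrow> real"
  assumes [measurable]: "Z \<in> borel_measurable M" and "integrable M (\<lambda>\<omega>. (Z \<omega>)\<^sup>2)"
  shows "(\<integral>\<^sup>+\<omega>. ennreal \<bar>Z \<omega>\<bar> \<partial>M) \<le> ennreal (sqrt (expectation (\<lambda>\<omega>. (Z \<omega>)\<^sup>2)))"
proof -
  have int: "integrable M (\<lambda>\<omega>. \<bar>Z \<omega>\<bar>)"
    by (rule integrable_abs, rule square_integrable_imp_integrable) (use assms in measurable)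
  have "variance (\<lambda>\<omega>. \<bar>Z \<omega>\<bar>) = expectation (\<lambda>\<omega>. (Z \<omega>)\<^sup>2) - (expectation (\<lambda>\<omega>. \<bar>Z \<omega>\<bar>))\<^sup>2"
    using variance_eq[OF int] assms(2) by simp
  with variance_positive[of "\<lambda>\<omega>. \<bar>Z \<omega>\<bar>"]
  have "expectation (\<lambda>\<omega>. \<bar>Z \<omega>\<bar>) \<le> sqrt (expectation (\<lambda>\<omega>. (Z \<omega>)\<^sup>2))"
    by (intro real_le_rsqrt) simp
  then show ?thesis
    by (subst nn_integral_eq_integral[OF int]) (simp_all add: ennreal_leI)
qed

text \<open>The variance of the mean is that of one summand divided by \<open>n\<close>. It is
  enlarged to the second moment, which is easy to bound for functions with values in a short
  interval [0, s]. The bound \<open>B\<close> supplies integrability and does not enter the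
  estimate.\<close>

lemma (in prob_space) iid_mean_deviation:
  fixes f :: "'b \<Rightarrow> real" and X :: "nat \<Rightarrow> 'a \<Rightarrow> 'b"
  assumes f[measurable]: "f \<in> borel_measurable N" and bound: "\<And>x. \<bar>f x\<bar> \<le> B"
    and indep: "indep_vars (\<lambda>_. N) X {..<n}" and P: "\<And>i. i < n \<Longrightarrow> distr M N (X i) = P" and "0 < n"
  shows "(\<integral>\<^sup>+\<omega>. ennreal \<bar>(\<Sum>i<n. f (X i \<omega>)) / n - (\<integral>x. f x \<partial>P)\<bar> \<partial>M)
    \<le> ennreal (sqrt ((\<integral>x. (f x)\<^sup>2 \<partial>P) / n))"
proof -
  define c where "c = (\<integral>x. f x \<partial>P)"
  define Y where "Y i \<omega> = f (X i \<omega>) - c" for i \<omega>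
  have X[measurable]: "X i \<in> M \<rightarrow>\<^sub>M N" if "i < n" for i
    using indep that by (auto simp: indep_vars_def)
  have "prob_space P"
    using prob_space_distr[OF X] P \<open>0 < n\<close> by metis
  then interpret P: prob_space P .
  have sP[measurable_cong]: "sets P = sets N"
    using P[OF \<open>0 < n\<close>] by (metis sets_distr)
  have intP: "integrable P f" "integrable P (\<lambda>x. (f x)\<^sup>2)"
  proof -
    show "integrable P f"
      using bound by (intro P.integrable_const_bound[of _ B]) simp_all
    have "\<bar>(f x)\<^sup>2\<bar> \<le> B\<^sup>2" for x
      using power_mono[OF bound[of x], of 2] by simp
    then show "integrable P (\<lambda>x. (f x)\<^sup>2)"
      by (intro P.integrable_const_bound[of _ "B\<^sup>2"]) simp_all
  qed
  have E: "expectation (\<lambda>\<omega>. u (X i \<omega>)) = (\<integral>x. u x \<partial>P)" if "i < n" and [measurable]: "u \<in> borel_measurable N" for u :: "'b \<Rightarrow> real" and i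
    using that P[OF that(1)] by (metis integral_distr X)
  have Ym[measurable]: "Y i \<in> borel_measurable M" if "i < n" for i
    using that unfolding Y_def by measurable
  have Yb: "\<bar>Y i \<omega>\<bar> \<le> B + \<bar>c\<bar>" for i \<omega>
    unfolding Y_def using bound[of "X i \<omega>"] by linarith
  have Yint: "integrable M (Y i)" if "i < n" for i
    using that Yb by (intro integrable_const_bound[of _ "B + \<bar>c\<bar>"]) auto
  have YYint: "integrable M (\<lambda>\<omega>. Y i \<omega> * Y j \<omega>)" if "i < n" "j < n" for i j
  proof -
    have "\<bar>Y i \<omega> * Y j \<omega>\<bar> \<le> (B + \<bar>c\<bar>) * (B + \<bar>c\<bar>)" for \<omega>
      unfolding abs_mult using Yb[of i \<omega>] Yb[of j \<omega>] by (intro mult_mono) auto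
    then show ?thesis
      using that by (intro integrable_const_bound[of _ "(B + \<bar>c\<bar>) * (B + \<bar>c\<bar>)"]) auto
  qed
  have Y0: "expectation (Y i) = 0" if "i < n" for i
  proof -
    have "expectation (Y i) = (\<integral>x. f x - c \<partial>P)"
      unfolding Y_def using that by (intro E[of i "\<lambda>x. f x - c"]) auto
    also have "\<dots> = 0"
      using intP by (simp add: c_def P.prob_space)
    finally show ?thesis .
  qed
  have YY0: "expectation (\<lambda>\<omega>. Y i \<omega> * Y j \<omega>) = 0" if "i < n" "j < n" "i \<noteq> j" for i j
  proof -
    have "indep_vars (\<lambda>_. borel) Y {..<n}"
      unfolding Y_def by (rule indep_vars_compose2[OF indep]) measurable
    then have "indep_vars (\<lambda>_. borel) Y {i, j}"
      using that by (elim indep_vars_subset) auto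
    then have "expectation (\<lambda>\<omega>. \<Prod>k\<in>{i, j}. Y k \<omega>) = (\<Prod>k\<in>{i, j}. expectation (Y k))"
      using that Yint by (intro indep_vars_lebesgue_integral) auto
    then show ?thesis using that Y0 by simp
  qed
  have YY: "expectation (\<lambda>\<omega>. (Y i \<omega>)\<^sup>2) \<le> (\<integral>x. (f x)\<^sup>2 \<partial>P)" if "i < n" for i
  proof -
    have "expectation (\<lambda>\<omega>. (Y i \<omega>)\<^sup>2) = P.variance f"
      unfolding Y_def c_def using that by (intro E[of i "\<lambda>x. (f x - (\<integral>x. f x \<partial>P))\<^sup>2"]) auto
    also have "\<dots> \<le> (\<integral>x. (f x)\<^sup>2 \<partial>P)"
      using intP by (subst P.variance_eq) auto
    finally show ?thesis .
  qed
  define Z where "Z \<omega> = (\<Sum>i<n. Y i \<omega>) / n" for \<omega>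
  have Z2: "(Z \<omega>)\<^sup>2 = (\<Sum>i<n. \<Sum>j<n. Y i \<omega> * Y j \<omega>) / (real n)\<^sup>2" for \<omega>
    unfolding Z_def power_divide by (simp add: power2_eq_square sum_product)
  have "expectation (\<lambda>\<omega>. (Z \<omega>)\<^sup>2) = (\<Sum>i<n. \<Sum>j<n. expectation (\<lambda>\<omega>. Y i \<omega> * Y j \<omega>)) / (real n)\<^sup>2"
  proof -
    have "expectation (\<lambda>\<omega>. \<Sum>i<n. \<Sum>j<n. Y i \<omega> * Y j \<omega>)
        = (\<Sum>i<n. expectation (\<lambda>\<omega>. \<Sum>j<n. Y i \<omega> * Y j \<omega>))"
      by (rule Bochner_Integration.integral_sum) (auto intro!: YYint)
    also have "\<dots> = (\<Sum>i<n. \<Sum>j<n. expectation (\<lambda>\<omega>. Y i \<omega> * Y j \<omega>))"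
      by (intro sum.cong refl Bochner_Integration.integral_sum) (auto intro!: YYint)
    finally show ?thesis unfolding Z2 by simp
  qed
  \<comment> \<open>The variables are centred and pairwise independent, so only the diagonal
    survives.\<close>
  also have "(\<Sum>i<n. \<Sum>j<n. expectation (\<lambda>\<omega>. Y i \<omega> * Y j \<omega>)) = (\<Sum>i<n. expectation (\<lambda>\<omega>. (Y i \<omega>)\<^sup>2))"
  proof (intro sum.cong refl)
    fix i assume i: "i \<in> {..<n}"
    have "(\<Sum>j<n. expectation (\<lambda>\<omega>. Y i \<omega> * Y j \<omega>)) = (\<Sum>j\<in>{i}. expectation (\<lambda>\<omega>. Y i \<omega> * Y j \<omega>))"
      using i YY0 by (intro sum.mono_neutral_right) auto
    then show "(\<Sum>j<n. expectation (\<lambda>\<omega>. Y i \<omega> * Y j \<omega>)) = expectation (\<lambda>\<omega>. (Y i \<omega>)\<^sup>2)"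
      by (simp add: power2_eq_square)
  qed
  also have "\<dots> / (real n)\<^sup>2 \<le> (\<Sum>i<n. (\<integral>x. (f x)\<^sup>2 \<partial>P)) / (real n)\<^sup>2"
    using YY by (intro divide_right_mono sum_mono) auto
  also have "\<dots> = (\<integral>x. (f x)\<^sup>2 \<partial>P) / n"
    by (simp add: power2_eq_square)
  finally have EZ: "expectation (\<lambda>\<omega>. (Z \<omega>)\<^sup>2) \<le> (\<integral>x. (f x)\<^sup>2 \<partial>P) / n" .
  have "(\<Sum>i<n. f (X i \<omega>)) / n - c = Z \<omega>" for \<omega>
    using \<open>0 < n\<close> by (simp add: Z_def Y_def sum_subtractf field_simps)
  then have "(\<integral>\<^sup>+\<omega>. ennreal \<bar>(\<Sum>i<n. f (X i \<omega>)) / n - c\<bar> \<partial>M) = (\<integral>\<^sup>+\<omega>. ennreal \<bar>Z \<omega>\<bar> \<partial>M)"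
    by simp
  also have "\<dots> \<le> ennreal (sqrt (expectation (\<lambda>\<omega>. (Z \<omega>)\<^sup>2)))"
  proof (rule nn_integral_abs_le_sqrt)
    show "Z \<in> borel_measurable M" unfolding Z_def by measurable
    show "integrable M (\<lambda>\<omega>. (Z \<omega>)\<^sup>2)" unfolding Z2 by (intro integrable_divide_zero Bochner_Integration.integrable_sum YYint) auto
  qed
  also have "\<dots> \<le> ennreal (sqrt ((\<integral>x. (f x)\<^sup>2 \<partial>P) / n))"
    using EZ by (intro ennreal_leI real_sqrt_le_mono)
  finally show ?thesis by (simp add: c_def)
qed

section \<open>Integration against the empirical measure\<close>

lemma prob_space_empirical_measure: "0 < n \<Longrightarrow> prob_space (empirical_measure n x)"
  unfolding empirical_measure_def
  by (intro prob_space.prob_space_distr prob_space_uniform_count_measure)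
    (auto simp: measurable_def sets_uniform_count_measure space_uniform_count_measure)

lemma sets_empirical_measure [simp]: "sets (empirical_measure n x) = sets borel"
  by (simp add: empirical_measure_def)

lemma nn_integral_empirical_measure:
  assumes [measurable]: "f \<in> borel_measurable borel" and "0 < n"
  shows "(\<integral>\<^sup>+y. f y \<partial>empirical_measure n x) = (\<Sum>i<n. f (x i)) / of_nat n"
proof -
  have x: "x \<in> measurable (uniform_count_measure {..<n}) borel"
    by (simp add: measurable_def sets_uniform_count_measure space_uniform_count_measure)
  have "(\<integral>\<^sup>+y. f y \<partial>empirical_measure n x) = (\<integral>\<^sup>+i. f (x i) \<partial>uniform_count_measure {..<n})"
    unfolding empirical_measure_def using x by (simp add: nn_integral_distr)
  also have "\<dots> = (\<Sum>i<n. ennreal (1 / n) * f (x i))"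
    unfolding uniform_count_measure_def by (subst nn_integral_point_measure_finite) auto
  also have "\<dots> = (\<Sum>i<n. f (x i)) / of_nat n"
    unfolding sum_distrib_left[symmetric] divide_ennreal_def using \<open>0 < n\<close>
    by (simp add: mult.commute inverse_ennreal ennreal_of_nat_eq_real_of_nat inverse_eq_divide)
  finally show ?thesis .
qed

section \<open>Sums over cells\<close>

lemma sum_sqrt_le:
  fixes f :: "'a \<Rightarrow> real"
  assumes "\<And>i. i \<in> A \<Longrightarrow> 0 \<le> f i"
  shows "(\<Sum>i\<in>A. sqrt (f i)) \<le> sqrt (card A * (\<Sum>i\<in>A. f i))"
proof (rule real_le_rsqrt)
  have "(\<Sum>i\<in>A. sqrt (f i))\<^sup>2 \<le> (\<Sum>i\<in>A. (sqrt (f i))\<^sup>2) * card A"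
    by (rule sum_squared_le_sum_of_squares)
  also have "(\<Sum>i\<in>A. (sqrt (f i))\<^sup>2) = (\<Sum>i\<in>A. f i)"
    using assms by (intro sum.cong) auto
  finally show "(\<Sum>i\<in>A. sqrt (f i))\<^sup>2 \<le> card A * (\<Sum>i\<in>A. f i)"
    by (simp add: mult.commute)
qed

lemma card_dyadic_children:
  fixes b :: "int ^ 'n"
  shows "finite {c. \<forall>i. c $ i div 2 ^ k = b $ i}"
    and "card {c :: int ^ 'n. \<forall>i. c $ i div 2 ^ k = b $ i} \<le> 2 ^ (k * CARD('n))"
proof -
  define F where "F = (\<Pi>\<^sub>E i\<in>(UNIV::'n set). {b $ i * 2 ^ k ..< b $ i * 2 ^ k + 2 ^ k})"
  have fin: "finite F" unfolding F_def by (intro finite_PiE) auto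
  have sub: "{c. \<forall>i. c $ i div 2 ^ k = b $ i} \<subseteq> vec_lambda ` F"
  proof
    fix c :: "int ^ 'n" assume "c \<in> {c. \<forall>i. c $ i div 2 ^ k = b $ i}"
    then have c: "c $ i div 2 ^ k = b $ i" for i by auto
    have "b $ i * 2 ^ k \<le> c $ i \<and> c $ i < b $ i * 2 ^ k + 2 ^ k" for i
    proof -
      have "0 \<le> c $ i mod 2 ^ k" "c $ i mod 2 ^ k < 2 ^ k" by simp_all
      with div_mult_mod_eq[of "c $ i" "2 ^ k"] show ?thesis unfolding c by linarith
    qed
    then have "vec_nth c \<in> F" by (auto simp: F_def)
    then show "c \<in> vec_lambda ` F" by (intro image_eqI[of _ _ "vec_nth c"]) auto
  qed
  with fin show "finite {c. \<forall>i. c $ i div 2 ^ k = b $ i}"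
    by (meson finite_imageI finite_subset)
  have "card {c. \<forall>i. c $ i div 2 ^ k = b $ i} \<le> card F"
    using sub fin by (meson card_image_le card_mono finite_imageI order_trans)
  also have "card F = 2 ^ (k * CARD('n))"
    by (simp add: F_def card_PiE power_mult nat_power_eq)
  finally show "card {c. \<forall>i. c $ i div 2 ^ k = b $ i} \<le> 2 ^ (k * CARD('n))" .
qed

text \<open>Cauchy-Schwarz is used only inside each unit cell, among its at most 2^(k d) subcells.
  The sum over the infinitely many unit cells is left as it is.\<close>

lemma sum_sqrt_children_le:
  fixes P :: "(real ^ 'n) measure"
  assumes "prob_space P" and sets: "sets P = sets borel"
  shows "(\<integral>\<^sup>+c. ennreal (sqrt (measure P (dyadic_cell k -` {c}))) \<partial>count_space UNIV)
    \<le> ennreal (sqrt (2 ^ (k * CARD('n)))) * (\<integral>\<^sup>+b. ennreal (sqrt (measure P (dyadic_cell 0 -` {b}))) \<partial>count_space UNIV)"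
proof -
  interpret prob_space P by fact
  note [measurable_cong] = sets
  define parent :: "int ^ 'n \<Rightarrow> int ^ 'n" where "parent c = (\<chi> i. c $ i div 2 ^ k)" for c
  define m where "m c = measure P (dyadic_cell k -` {c})" for c
  have parent: "parent (dyadic_cell k x) = dyadic_cell 0 x" for x
    by (simp add: parent_def vec_eq_iff dyadic_cell_ancestor[of 0 x _ k])
  have "(\<integral>\<^sup>+c. ennreal (sqrt (m c)) \<partial>count_space UNIV)
    = (\<integral>\<^sup>+b. (\<integral>\<^sup>+c. ennreal (sqrt (m c)) * indicator {b} (parent c) \<partial>count_space UNIV) \<partial>count_space UNIV)"
    by (rule nn_integral_partition) auto
  also have "\<dots> \<le> (\<integral>\<^sup>+b. ennreal (sqrt (2 ^ (k * CARD('n)))) * ennreal (sqrt (measure P (dyadic_cell 0 -` {b}))) \<partial>count_space UNIV)"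
  proof (intro nn_integral_mono)
    fix b :: "int ^ 'n"
    define A where "A = {c. \<forall>i. c $ i div 2 ^ k = b $ i}"
    have A: "finite A" "card A \<le> 2 ^ (k * CARD('n))"
      unfolding A_def by (rule card_dyadic_children)+
    have A_iff: "c \<in> A \<longleftrightarrow> parent c = b" for c
      by (simp add: A_def parent_def vec_eq_iff)
    have "(\<integral>\<^sup>+c. ennreal (sqrt (m c)) * indicator {b} (parent c) \<partial>count_space UNIV)
      = (\<Sum>c\<in>A. ennreal (sqrt (m c)) * indicator {b} (parent c))"
      using A by (intro nn_integral_count_space') (auto simp: A_iff)
    also have "\<dots> = ennreal (\<Sum>c\<in>A. sqrt (m c))"
      by (subst sum_ennreal[symmetric]) (auto simp: A_iff m_def intro!: sum.cong)
    also have "\<dots> \<le> ennreal (sqrt (2 ^ (k * CARD('n)) * measure P (dyadic_cell 0 -` {b})))"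
    proof (rule ennreal_leI)
      have "(\<Sum>c\<in>A. m c) = measure P (\<Union>c\<in>A. dyadic_cell k -` {c})"
        unfolding m_def using A
        by (intro finite_measure_finite_Union[symmetric]) (auto simp: sets disjoint_family_on_def)
      also have "(\<Union>c\<in>A. dyadic_cell k -` {c}) = dyadic_cell 0 -` {b}"
        by (auto simp: A_iff parent)
      finally have sum: "(\<Sum>c\<in>A. m c) = measure P (dyadic_cell 0 -` {b})" .
      have "real (card A) \<le> 2 ^ (k * CARD('n))"
        using A(2) by (metis of_nat_le_iff of_nat_numeral of_nat_power)
      then have "card A * measure P (dyadic_cell 0 -` {b}) \<le> 2 ^ (k * CARD('n)) * measure P (dyadic_cell 0 -` {b})"
        by (intro mult_right_mono) auto
      with sum_sqrt_le[of A m] show "(\<Sum>c\<in>A. sqrt (m c)) \<le> sqrt (2 ^ (k * CARD('n)) * measure P (dyadic_cell 0 -` {b}))"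
        unfolding sum by (simp add: m_def) (meson order_trans real_sqrt_le_mono)
    qed
    finally show "(\<integral>\<^sup>+c. ennreal (sqrt (m c)) * indicator {b} (parent c) \<partial>count_space UNIV)
      \<le> ennreal (sqrt (2 ^ (k * CARD('n)))) * ennreal (sqrt (measure P (dyadic_cell 0 -` {b})))"
      by (simp add: real_sqrt_mult ennreal_mult)
  qed
  also have "\<dots> = ennreal (sqrt (2 ^ (k * CARD('n)))) * (\<integral>\<^sup>+b. ennreal (sqrt (measure P (dyadic_cell 0 -` {b}))) \<partial>count_space UNIV)"
    by (rule nn_integral_cmult) auto
  finally show ?thesis by (simp add: m_def)
qed

section \<open>Exponential sums over the integer lattice\<close>

lemma abs_summable_on_exp_int: "Infinite_Set_Sum.abs_summable_on (\<lambda>k::int. exp (- \<bar>real_of_int k\<bar>)) UNIV"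
proof -
  have *: "Infinite_Set_Sum.abs_summable_on (\<lambda>n::nat. exp (- real n)) UNIV"
  proof -
    have "summable (\<lambda>n::nat. exp (- 1 :: real) ^ n)"
      by (rule summable_geometric) simp
    then show ?thesis
      by (simp add: abs_summable_on_nat_iff' exp_of_nat_mult[symmetric])
  qed
  have "Infinite_Set_Sum.abs_summable_on (\<lambda>k::int. exp (- \<bar>real_of_int k\<bar>)) (range int)"
    using * by (subst abs_summable_on_reindex_iff[symmetric]) auto
  moreover have "Infinite_Set_Sum.abs_summable_on (\<lambda>k::int. exp (- \<bar>real_of_int k\<bar>)) (range (\<lambda>n. - int n))"
    using * by (subst abs_summable_on_reindex_iff[symmetric]) (auto intro: injI)
  ultimately have "Infinite_Set_Sum.abs_summable_on (\<lambda>k::int. exp (- \<bar>real_of_int k\<bar>)) (range int \<union> range (\<lambda>n. - int n))"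
    by (rule abs_summable_on_union)
  also have "range int \<union> range (\<lambda>n. - int n) = UNIV"
  proof -
    have "k \<in> range int \<union> range (\<lambda>n. - int n)" for k
      by (cases k rule: int_cases2) auto
    then show ?thesis by blast
  qed
  finally show ?thesis .
qed

text \<open>A constant of the dimension alone, which the type argument carries.\<close>

definition lattice_sum :: "'n::finite itself \<Rightarrow> ennreal" where
  "lattice_sum _ = (\<integral>\<^sup>+c. ennreal (exp (- (\<Sum>i\<in>UNIV. \<bar>real_of_int (c $ i)\<bar>))) \<partial>count_space (UNIV :: (int ^ 'n) set))"

text \<open>The summand is a product over the coordinates, so the sum reduces to a two-sided
  geometric series for each of them.\<close>

lemma lattice_sum_finite: "lattice_sum TYPE('n::finite) < \<infinity>"
proof -
  have "Infinite_Set_Sum.abs_summable_on (\<lambda>g. \<Prod>i\<in>(UNIV::'n set). exp (- \<bar>real_of_int (g i)\<bar>)) (\<Pi>\<^sub>E i\<in>UNIV. UNIV)"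
    using abs_summable_on_exp_int by (intro abs_summable_on_prod_PiE) auto
  then have "Infinite_Set_Sum.abs_summable_on (\<lambda>g. exp (- (\<Sum>i\<in>(UNIV::'n set). \<bar>real_of_int (g i)\<bar>))) UNIV"
    by (simp add: exp_sum[symmetric] sum_negf)
  then have "(\<integral>\<^sup>+g. ennreal (exp (- (\<Sum>i\<in>(UNIV::'n set). \<bar>real_of_int (g i)\<bar>))) \<partial>count_space UNIV) < \<infinity>"
    by (simp add: abs_summable_on_def integrable_iff_bounded)
  also have "(\<integral>\<^sup>+g. ennreal (exp (- (\<Sum>i\<in>(UNIV::'n set). \<bar>real_of_int (g i)\<bar>))) \<partial>count_space UNIV) = lattice_sum TYPE('n)"
    unfolding lattice_sum_def
    by (intro nn_integral_bij_count_space[symmetric, of vec_nth, OF bij_betwI'])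
      (auto simp: vec_nth_inject intro: vec_lambda_beta[symmetric] exI[of _ "vec_lambda _"])
  finally show ?thesis .
qed

text \<open>Translation invariance of the lattice makes later bounds independent of where a set of
  the partition lies.\<close>

lemma lattice_sum_shift:
  fixes a :: "int ^ 'n"
  shows "(\<integral>\<^sup>+c. ennreal (exp (- (\<Sum>i\<in>UNIV. \<bar>real_of_int (c $ i) - a $ i\<bar>))) \<partial>count_space UNIV) = lattice_sum TYPE('n)"
proof -
  have "bij_betw (\<lambda>c. c - a) UNIV UNIV"
    by (rule bij_betwI[of _ _ _ "\<lambda>c. c + a"]) auto
  from nn_integral_bij_count_space[OF this, of "\<lambda>c. ennreal (exp (- (\<Sum>i\<in>UNIV. \<bar>real_of_int (c $ i)\<bar>)))"]
  show ?thesis by (simp add: lattice_sum_def)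
qed

text \<open>The l2 norm is at most the l1 norm: each \<open>y j\<close> is at most the total
  \<open>t\<close>, so the squares sum to at most \<open>t * t\<close>. This moves a square root
  inside the sum over the partition and so produces the terms P(I_j)^(1/2).\<close>

lemma ennreal_sqrt_le_suminf:
  assumes "ennreal m \<le> (\<Sum>j. (ennreal (y j))\<^sup>2)" "0 \<le> m"
  shows "ennreal (sqrt m) \<le> (\<Sum>j. ennreal (y j))"
proof (cases "(\<Sum>j. ennreal (y j))")
  case (real t)
  have le: "ennreal (y j) \<le> (\<Sum>j. ennreal (y j))" for j
    using sum_le_suminf[of "\<lambda>j. ennreal (y j)" "{j}"] by simp
  note assms(1)
  also have "(\<Sum>j. (ennreal (y j))\<^sup>2) \<le> (\<Sum>j. ennreal t * ennreal (y j))"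
    using le real by (intro suminf_le summableI) (auto simp: power2_eq_square intro!: mult_right_mono)
  also have "\<dots> = ennreal t * ennreal t"
    using real by simp
  finally have "m \<le> t * t"
    using real by (simp flip: ennreal_mult)
  then have "sqrt m \<le> t"
    using real by (intro real_le_lsqrt) (auto simp: power2_eq_square assms)
  then show ?thesis using real by (simp add: ennreal_leI)
qed simp

section \<open>Smoothed empirical measures\<close>

lemma borel_measurable_nn_integral_count_space:
  fixes f :: "'c::countable \<Rightarrow> 'a \<Rightarrow> ennreal"
  assumes [measurable]: "\<And>c. f c \<in> borel_measurable M"
  shows "(\<lambda>x. \<integral>\<^sup>+c. f c x \<partial>count_space UNIV) \<in> borel_measurable M"
proof -
  interpret sigma_finite_measure "count_space (UNIV :: 'c set)"
    by (intro sigma_finite_measure_count_space_countable) simp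
  have "(\<lambda>(c, x). f c x) \<in> borel_measurable (count_space UNIV \<Otimes>\<^sub>M M)"
    by (rule measurable_pair_measure_countable1) auto
  from measurable_compose[OF measurable_pair_swap' this]
  have "(\<lambda>(x, c). f c x) \<in> borel_measurable (M \<Otimes>\<^sub>M count_space UNIV)"
    by (simp add: case_prod_beta')
  then show ?thesis
    by (rule borel_measurable_nn_integral)
qed

text \<open>The noise is kept abstract so that the Gaussian and the point mass at 0, which is no
  noise at all, are treated by the same argument.\<close>

locale smoothing_kernel = prob_space \<kappa> for \<kappa> :: "(real ^ 'n) measure" +
  assumes sets_kernel [measurable_cong]: "sets \<kappa> = sets borel"
begin

definition shifted :: "(real ^ 'n) set \<Rightarrow> real ^ 'n \<Rightarrow> real" where
  "shifted A x = prob {z. x + z \<in> A}"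

lemma space_kernel: "space \<kappa> = UNIV"
  using sets_kernel[THEN sets_eq_imp_space_eq] by simp

lemma sets_shift [measurable]:
  fixes A :: "(real ^ 'n) set"
  assumes [measurable]: "A \<in> sets borel" shows "{z. x + z \<in> A} \<in> sets borel"
proof -
  have "(\<lambda>z. x + z) -` A \<inter> space (borel :: (real ^ 'n) measure) \<in> sets (borel :: (real ^ 'n) measure)"
    by measurable
  then show ?thesis by (simp add: vimage_def)
qed

lemma emeasure_shift:
  assumes "A \<in> sets borel"
  shows "emeasure \<kappa> {z. x + z \<in> A} = (\<integral>\<^sup>+z. indicator A (x + z) \<partial>\<kappa>)"
proof -
  have "(\<integral>\<^sup>+z. indicator A (x + z) \<partial>\<kappa>) = (\<integral>\<^sup>+z. indicator {z. x + z \<in> A} z \<partial>\<kappa>)"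
    by (intro nn_integral_cong) (auto split: split_indicator)
  then show ?thesis using sets_shift[OF assms] by (simp add: sets_kernel)
qed

lemma shifted_nonneg: "0 \<le> shifted A x" and shifted_le_1: "shifted A x \<le> 1"
  by (simp_all add: shifted_def)

lemma borel_measurable_shifted:
  assumes [measurable]: "A \<in> sets borel" shows "shifted A \<in> borel_measurable borel"
proof -
  have "(\<lambda>x. \<integral>\<^sup>+z. indicator A (x + z) \<partial>\<kappa>) \<in> borel_measurable borel"
    by measurable
  then have "(\<lambda>x. enn2real (emeasure \<kappa> {z. x + z \<in> A})) \<in> borel_measurable borel"
    by (simp add: emeasure_shift)
  then show ?thesis by (simp add: shifted_def[abs_def] measure_def)
qed

lemma emeasure_smoothed:
  assumes "prob_space P" "sets P = sets borel" and A: "A \<in> sets borel"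
  shows "emeasure (P \<star> \<kappa>) A = (\<integral>\<^sup>+x. ennreal (shifted A x) \<partial>P)"
proof -
  have "finite_measure P" "finite_measure \<kappa>"
    using assms finite_measure_axioms by (auto simp: prob_space.finite_measure)
  from convolution_emeasure'[OF A this sets_kernel assms(2)]
  show ?thesis
    by (simp add: shifted_def emeasure_shift[OF A, symmetric] flip: emeasure_eq_measure)
qed

lemma prob_space_smoothed:
  assumes "prob_space P" "sets P = sets borel" shows "prob_space (P \<star> \<kappa>)"
proof
  interpret P: prob_space P by fact
  have "{z. x + z \<in> UNIV} = space \<kappa>" for x by (simp add: space_kernel)
  then show "emeasure (P \<star> \<kappa>) (space (P \<star> \<kappa>)) = 1"
    using emeasure_smoothed[OF assms, of UNIV]
    by (simp add: shifted_def prob_space P.emeasure_space_1 del: Collect_const)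
qed

lemma measure_smoothed:
  assumes "prob_space P" "sets P = sets borel" and A: "A \<in> sets borel"
  shows "measure (P \<star> \<kappa>) A = (\<integral>x. shifted A x \<partial>P)"
proof -
  interpret P: prob_space P by fact
  note [measurable_cong] = assms(2) and [measurable] = borel_measurable_shifted[OF A]
  have "integrable P (shifted A)"
    by (intro P.integrable_const_bound[of _ 1]) (auto simp: shifted_nonneg shifted_le_1)
  then have "emeasure (P \<star> \<kappa>) A = ennreal (\<integral>x. shifted A x \<partial>P)"
    unfolding emeasure_smoothed[OF assms] by (intro nn_integral_eq_integral) (auto simp: shifted_nonneg)
  then show ?thesis
    by (simp add: measure_def integral_nonneg_AE shifted_nonneg)
qed

text \<open>For a fixed set the smoothed empirical mass is thus an empirical mean of a bounded
  function of the sample points.\<close>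

lemma measure_smoothed_empirical:
  assumes A: "A \<in> sets borel" and "0 < n"
  shows "measure (empirical_measure n x \<star> \<kappa>) A = (\<Sum>i<n. shifted A (x i)) / n"
proof -
  have "emeasure (empirical_measure n x \<star> \<kappa>) A = (\<Sum>i<n. ennreal (shifted A (x i))) / of_nat n"
    using assms borel_measurable_shifted[OF A]
    by (simp add: emeasure_smoothed prob_space_empirical_measure nn_integral_empirical_measure)
  also have "\<dots> = ennreal ((\<Sum>i<n. shifted A (x i)) / n)"
    using \<open>0 < n\<close> by (simp add: sum_ennreal shifted_nonneg sum_nonneg divide_ennreal ennreal_of_nat_eq_real_of_nat)
  finally show ?thesis
    by (simp add: measure_def sum_nonneg shifted_nonneg)
qed

text \<open>A function with values in [0, s] satisfies f^2 <= s * f, so its second moment is at most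
  s times its mean, and the mean is the smoothed mass of \<open>A\<close>.\<close>

lemma expected_smoothed_deviation:
  fixes X :: "nat \<Rightarrow> 'w \<Rightarrow> real ^ 'n"
  assumes P: "prob_space P" "sets P = sets borel" and S: "prob_space S"
    and indep: "prob_space.indep_vars S (\<lambda>_. borel) X {..<n}"
    and law: "\<And>i. i < n \<Longrightarrow> distr S borel (X i) = P" and "0 < n"
    and A: "A \<in> sets borel" and s: "\<And>x. shifted A x \<le> s"
  shows "(\<integral>\<^sup>+\<omega>. ennreal \<bar>measure (empirical_measure n (\<lambda>i. X i \<omega>) \<star> \<kappa>) A - measure (P \<star> \<kappa>) A\<bar> \<partial>S)
    \<le> ennreal (sqrt (s / n) * sqrt (measure (P \<star> \<kappa>) A))"
proof -
  interpret P: prob_space P by fact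
  interpret S: prob_space S by fact
  note [measurable_cong] = P(2) and [measurable] = borel_measurable_shifted[OF A]
  have int: "integrable P (shifted A)"
    by (intro P.integrable_const_bound[of _ 1]) (auto simp: shifted_nonneg shifted_le_1)
  have sq: "(shifted A x)\<^sup>2 \<le> s * shifted A x" for x
    unfolding power2_eq_square by (intro mult_right_mono s shifted_nonneg)
  have "(\<integral>\<^sup>+\<omega>. ennreal \<bar>measure (empirical_measure n (\<lambda>i. X i \<omega>) \<star> \<kappa>) A - measure (P \<star> \<kappa>) A\<bar> \<partial>S)
    = (\<integral>\<^sup>+\<omega>. ennreal \<bar>(\<Sum>i<n. shifted A (X i \<omega>)) / n - (\<integral>x. shifted A x \<partial>P)\<bar> \<partial>S)"
    using A \<open>0 < n\<close> P by (simp add: measure_smoothed_empirical measure_smoothed)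
  also have "\<dots> \<le> ennreal (sqrt ((\<integral>x. (shifted A x)\<^sup>2 \<partial>P) / n))"
    by (rule S.iid_mean_deviation[OF _ _ indep law \<open>0 < n\<close>, of _ 1])
      (auto simp: shifted_nonneg shifted_le_1)
  also have "\<dots> \<le> ennreal (sqrt (s * measure (P \<star> \<kappa>) A / n))"
  proof (intro ennreal_leI real_sqrt_le_mono divide_right_mono)
    have "(\<integral>x. (shifted A x)\<^sup>2 \<partial>P) \<le> (\<integral>x. s * shifted A x \<partial>P)"
    proof (rule integral_mono)
      have "\<bar>(shifted A x)\<^sup>2\<bar> \<le> 1" for x
        using shifted_nonneg[of A x] shifted_le_1[of A x] by (simp add: power_le_one)
      then show "integrable P (\<lambda>x. (shifted A x)\<^sup>2)"
        by (intro P.integrable_const_bound[of _ 1]) auto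
    qed (use int sq in auto)
    then show "(\<integral>x. (shifted A x)\<^sup>2 \<partial>P) \<le> s * measure (P \<star> \<kappa>) A"
      using A P by (simp add: measure_smoothed)
  qed simp
  finally show ?thesis by (simp add: real_sqrt_mult real_sqrt_divide mult.commute)
qed

lemma borel_measurable_smoothed_deviation:
  fixes X :: "nat \<Rightarrow> 'w \<Rightarrow> real ^ 'n"
  assumes X: "\<And>i. i < n \<Longrightarrow> X i \<in> borel_measurable S" and A: "A \<in> sets borel" and "0 < n"
  shows "(\<lambda>\<omega>. ennreal \<bar>measure (empirical_measure n (\<lambda>i. X i \<omega>) \<star> \<kappa>) A - r\<bar>) \<in> borel_measurable S"
proof -
  have [measurable]: "(\<lambda>\<omega>. shifted A (X i \<omega>)) \<in> borel_measurable S" if "i < n" for i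
    using measurable_compose[OF X[OF that] borel_measurable_shifted[OF A]] .
  have "(\<lambda>\<omega>. \<Sum>i<n. shifted A (X i \<omega>)) \<in> borel_measurable S"
    by (intro borel_measurable_sum) auto
  then show ?thesis
    using A \<open>0 < n\<close> by (simp add: measure_smoothed_empirical)
qed

text \<open>
  A point of \<open>I j\<close> reaches the unit cell \<open>b\<close> only if the noise is about as large as the distance
  from \<open>I j\<close> to \<open>b\<close>. By the exponential moment of the noise this probability is at most
  \<open>L * exp (- 4 * N j b)\<close>; its square root still decays fast enough to absorb the growth of
  \<open>cell_radius b\<close> and to be summed over the lattice.
\<close>

lemma weighted_sqrt_cells_le:
  fixes P :: "(real ^ 'n) measure" and I :: "nat \<Rightarrow> (real ^ 'n) set"
    and K V :: real and M :: "nat \<Rightarrow> real"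
  assumes P: "prob_space P" and sets: "sets P = sets borel"
    and I: "(\<Union>j. I j) = UNIV" "disjoint_family I" "\<And>j. I j \<in> sets borel" "\<And>j. I j \<noteq> {}"
    and K: "\<And>j x y. x \<in> I j \<Longrightarrow> y \<in> I j \<Longrightarrow> dist x y \<le> K"
    and M: "\<And>j x. x \<in> I j \<Longrightarrow> norm x \<le> M j" "\<And>j. 1 \<le> M j"
    and summable: "summable (\<lambda>j. M j * sqrt (measure P (I j)))"
    and V: "(\<integral>\<^sup>+z. ennreal (exp (4 * (\<Sum>i\<in>UNIV. \<bar>z $ i\<bar>))) \<partial>\<kappa>) \<le> ennreal V" "0 \<le> V"
  shows "(\<integral>\<^sup>+b. ennreal (cell_radius b) * ennreal (sqrt (measure (P \<star> \<kappa>) (dyadic_cell 0 -` {b}))) \<partial>count_space UNIV)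
    \<le> ennreal (3 * CARD('n) * exp (2 * CARD('n) * (K + 1)) * sqrt V * enn2real (lattice_sum TYPE('n))
        * (\<Sum>j. M j * sqrt (measure P (I j))))"
proof -
  interpret P: prob_space P by fact
  interpret PK: prob_space "P \<star> \<kappa>" by (rule prob_space_smoothed[OF P sets])
  note [measurable_cong] = sets
  define d where "d = real CARD('n)"
  have d1: "1 \<le> d" unfolding d_def by (simp add: Suc_leI)
  \<comment> \<open>The unit cell of an arbitrary point of \<open>I j\<close>. Since diameters are
    at most \<open>K\<close>, it locates the whole set up to a bounded error; \<open>N j b\<close>
    is the l1 distance from it in the lattice.\<close>
  define a where "a j = dyadic_cell 0 (SOME x. x \<in> I j)" for j
  have a: "\<exists>x\<in>I j. a j = dyadic_cell 0 x" for j
    unfolding a_def using I(4)[of j] by (auto intro: someI)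
  define N where "N j b = (\<Sum>i\<in>UNIV. \<bar>real_of_int (b $ i) - a j $ i\<bar>)" for j and b :: "int ^ 'n"
  have N0: "0 \<le> N j b" for j b by (auto simp: N_def intro: sum_nonneg)
  define L where "L = exp (4 * d * (K + 1)) * V"
  have L0: "0 \<le> L" using V by (simp add: L_def)
  \<comment> \<open>In each coordinate the two floors differ by at most the noise, plus
    \<open>K\<close> for the choice of the reference point, plus 1 for rounding.\<close>
  have near: "N j (dyadic_cell 0 (x + z)) \<le> (\<Sum>i\<in>UNIV. \<bar>z $ i\<bar>) + d * (K + 1)" if "x \<in> I j" for x z j
  proof -
    obtain y where y: "y \<in> I j" "a j = dyadic_cell 0 y" using a by blast
    have "\<bar>real_of_int (dyadic_cell 0 (x + z) $ i) - a j $ i\<bar> \<le> \<bar>z $ i\<bar> + (K + 1)" for i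
    proof -
      have "\<bar>x $ i - y $ i\<bar> \<le> K"
        using K[OF that y(1)] component_le_norm_cart[of "x - y" i] by (simp add: dist_norm)
      then show ?thesis unfolding y(2) dyadic_cell_def by simp linarith
    qed
    then have "N j (dyadic_cell 0 (x + z)) \<le> (\<Sum>i\<in>UNIV. \<bar>z $ i\<bar> + (K + 1))"
      unfolding N_def by (intro sum_mono)
    then show ?thesis by (simp add: sum.distrib d_def)
  qed
  \<comment> \<open>Exponential Markov inequality: on the event the exponent is nonnegative, so the
    integrand is at least 1.\<close>
  have markov: "ennreal (shifted (dyadic_cell 0 -` {b}) x) \<le> ennreal (L * exp (- 4 * N j b))" if "x \<in> I j" for x j b
  proof -
    have "ennreal (shifted (dyadic_cell 0 -` {b}) x) = (\<integral>\<^sup>+z. indicator (dyadic_cell 0 -` {b}) (x + z) \<partial>\<kappa>)"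
      by (simp add: shifted_def emeasure_shift[symmetric] emeasure_eq_measure)
    also have "\<dots> \<le> (\<integral>\<^sup>+z. ennreal (exp (4 * d * (K + 1) - 4 * N j b)) * ennreal (exp (4 * (\<Sum>i\<in>UNIV. \<bar>z $ i\<bar>))) \<partial>\<kappa>)"
    proof (intro nn_integral_mono)
      fix z
      have "1 \<le> exp (4 * d * (K + 1) - 4 * N j b) * exp (4 * (\<Sum>i\<in>UNIV. \<bar>z $ i\<bar>))"
        if "dyadic_cell 0 (x + z) = b"
        using near[OF \<open>x \<in> I j\<close>, of z] that by (simp add: exp_add[symmetric] algebra_simps)
      then show "indicator (dyadic_cell 0 -` {b}) (x + z) \<le> ennreal (exp (4 * d * (K + 1) - 4 * N j b)) * ennreal (exp (4 * (\<Sum>i\<in>UNIV. \<bar>z $ i\<bar>)))"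
        by (auto simp flip: ennreal_mult split: split_indicator)
    qed
    also have "\<dots> = ennreal (exp (4 * d * (K + 1) - 4 * N j b)) * (\<integral>\<^sup>+z. ennreal (exp (4 * (\<Sum>i\<in>UNIV. \<bar>z $ i\<bar>))) \<partial>\<kappa>)"
    proof (rule nn_integral_cmult)
      note [measurable] = borel_measurable_vec_nth
      show "(\<lambda>z. ennreal (exp (4 * (\<Sum>i\<in>UNIV. \<bar>z $ i\<bar>)))) \<in> borel_measurable \<kappa>"
        by measurable
    qed
    also have "\<dots> \<le> ennreal (exp (4 * d * (K + 1) - 4 * N j b)) * ennreal V"
      by (intro mult_left_mono V) simp
    also have "\<dots> = ennreal (L * exp (- 4 * N j b))"
      using V(2) by (simp add: L_def ennreal_mult[symmetric] exp_diff exp_minus field_simps)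
    finally show ?thesis .
  qed
  \<comment> \<open>\<open>(y j b)\<^sup>2\<close> bounds the contribution of \<open>I j\<close> to
    the smoothed mass of \<open>b\<close>. The rate 4 is chosen for what follows: the square root
    halves it to 2, \<open>cell_radius\<close> consumes 1, and 1 remains for summing over the
    lattice.\<close>
  define y where "y j b = sqrt L * exp (- 2 * N j b) * sqrt (measure P (I j))" for j b
  have y0: "0 \<le> y j b" for j b using L0 by (simp add: y_def)
  have y2: "(y j b)\<^sup>2 = L * exp (- 4 * N j b) * measure P (I j)" for j b
    using L0 by (simp add: y_def power_mult_distrib exp_double[symmetric])
  have cell: "ennreal (sqrt (measure (P \<star> \<kappa>) (dyadic_cell 0 -` {b}))) \<le> (\<Sum>j. ennreal (y j b))" for b
  proof (rule ennreal_sqrt_le_suminf)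
    let ?f = "\<lambda>x. ennreal (shifted (dyadic_cell 0 -` {b}) x)"
    have [measurable]: "shifted (dyadic_cell 0 -` {b}) \<in> borel_measurable borel"
      by (intro borel_measurable_shifted dyadic_cell_vimage_borel)
    have [measurable]: "I j \<in> sets borel" for j by (rule I)
    have "ennreal (measure (P \<star> \<kappa>) (dyadic_cell 0 -` {b})) = (\<integral>\<^sup>+x. ?f x \<partial>P)"
      by (simp add: PK.emeasure_eq_measure[symmetric] emeasure_smoothed[OF P sets])
    also have "\<dots> = (\<integral>\<^sup>+x. (\<Sum>j. ?f x * indicator (I j) x) \<partial>P)"
    proof (intro nn_integral_cong)
      fix x obtain i where "x \<in> I i" using I(1) by blast
      from suminf_cmult_indicator[OF I(2) this, of "\<lambda>_. ?f x"]
      show "?f x = (\<Sum>j. ?f x * indicator (I j) x)" by simp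
    qed
    also have "\<dots> = (\<Sum>j. \<integral>\<^sup>+x. ?f x * indicator (I j) x \<partial>P)"
      by (rule nn_integral_suminf) measurable
    also have "\<dots> \<le> (\<Sum>j. (ennreal (y j b))\<^sup>2)"
    proof (intro suminf_le summableI)
      fix j
      have "(\<integral>\<^sup>+x. ?f x * indicator (I j) x \<partial>P) \<le> (\<integral>\<^sup>+x. ennreal (L * exp (- 4 * N j b)) * indicator (I j) x \<partial>P)"
        using markov by (intro nn_integral_mono) (auto split: split_indicator)
      also have "\<dots> = ennreal ((y j b)\<^sup>2)"
        unfolding y2 using L0 sets I(3)
        by (simp add: nn_integral_cmult_indicator P.emeasure_eq_measure ennreal_mult)
      finally show "(\<integral>\<^sup>+x. ?f x * indicator (I j) x \<partial>P) \<le> (ennreal (y j b))\<^sup>2"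
        using y0 by (simp add: ennreal_power)
    qed
    finally show "ennreal (measure (P \<star> \<kappa>) (dyadic_cell 0 -` {b})) \<le> (\<Sum>j. (ennreal (y j b))\<^sup>2)" .
  qed simp
  \<comment> \<open>The radius grows linearly in \<open>M j\<close> and \<open>N j b\<close>. As
    \<open>M j\<close> and the dimension are at least 1, all additive constants can be absorbed into
    a product, and 1 + N <= exp N.\<close>
  have radius: "cell_radius b \<le> 3 * d * M j * exp (N j b)" for b j
  proof -
    obtain u where u: "u \<in> I j" "a j = dyadic_cell 0 u" using a by blast
    have "\<bar>real_of_int (b $ i)\<bar> + 1 \<le> (M j + 2) + \<bar>real_of_int (b $ i) - a j $ i\<bar>" for i
    proof -
      have "\<bar>u $ i\<bar> \<le> M j"
        using component_le_norm_cart[of u i] M(1)[OF u(1)] by linarith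
      then have "\<bar>real_of_int (a j $ i)\<bar> \<le> M j + 1"
        unfolding u(2) dyadic_cell_def by simp linarith
      then show ?thesis by linarith
    qed
    then have "cell_radius b \<le> (\<Sum>i\<in>UNIV. (M j + 2) + \<bar>real_of_int (b $ i) - a j $ i\<bar>)"
      unfolding cell_radius_def by (intro sum_mono)
    also have "\<dots> = d * (M j + 2) + N j b"
      by (simp add: sum.distrib d_def N_def)
    also have "\<dots> \<le> 3 * d * M j + 3 * d * M j * N j b"
    proof (rule add_mono)
      have "d * (M j + 2) \<le> d * (3 * M j)" using M(2)[of j] d1 by (intro mult_left_mono) auto
      then show "d * (M j + 2) \<le> 3 * d * M j" by (simp add: ac_simps)
      have "1 * 1 \<le> d * M j" using M(2)[of j] d1 by (intro mult_mono) auto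
      then have "1 * N j b \<le> (3 * (d * M j)) * N j b" using N0 by (intro mult_right_mono) auto
      then show "N j b \<le> 3 * d * M j * N j b" by (simp add: ac_simps)
    qed
    also have "\<dots> = 3 * d * M j * (1 + N j b)" by (simp add: algebra_simps)
    also have "\<dots> \<le> 3 * d * M j * exp (N j b)"
      using d1 M(2)[of j] by (intro mult_left_mono exp_ge_add_one_self) auto
    finally show ?thesis .
  qed
  define C where "C = 3 * d * sqrt L"
  have C0: "0 \<le> C" using d1 L0 by (simp add: C_def)
  have bound: "cell_radius b * y j b \<le> C * (M j * sqrt (measure P (I j))) * exp (- N j b)" for b j
  proof -
    have "cell_radius b * y j b \<le> (3 * d * M j * exp (N j b)) * y j b"
      by (intro mult_right_mono radius y0)
    also have "\<dots> = C * (M j * sqrt (measure P (I j))) * (exp (N j b) * exp (- 2 * N j b))"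
      by (simp add: y_def C_def ac_simps)
    also have "exp (N j b) * exp (- 2 * N j b) = exp (- N j b)"
      by (simp add: exp_add[symmetric])
    finally show ?thesis .
  qed
  have lat: "lattice_sum TYPE('n) = ennreal (enn2real (lattice_sum TYPE('n)))"
    using lattice_sum_finite[where 'n='n] by simp
  have "(\<integral>\<^sup>+b. ennreal (cell_radius b) * ennreal (sqrt (measure (P \<star> \<kappa>) (dyadic_cell 0 -` {b}))) \<partial>count_space UNIV)
    \<le> (\<integral>\<^sup>+b. (\<Sum>j. ennreal (cell_radius b) * ennreal (y j b)) \<partial>count_space UNIV)"
    using cell by (intro nn_integral_mono) (simp add: mult_left_mono)
  also have "\<dots> = (\<Sum>j. \<integral>\<^sup>+b. ennreal (cell_radius b) * ennreal (y j b) \<partial>count_space UNIV)"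
    by (rule nn_integral_suminf) simp
  also have "\<dots> \<le> (\<Sum>j. ennreal (C * enn2real (lattice_sum TYPE('n)) * (M j * sqrt (measure P (I j)))))"
  proof (intro suminf_le summableI)
    fix j
    have M0: "0 \<le> M j * sqrt (measure P (I j))" using M(2)[of j] by simp
    have "(\<integral>\<^sup>+b. ennreal (cell_radius b) * ennreal (y j b) \<partial>count_space UNIV)
      \<le> (\<integral>\<^sup>+b. ennreal (C * (M j * sqrt (measure P (I j)))) * ennreal (exp (- N j b)) \<partial>count_space UNIV)"
      using bound M0 C0 by (intro nn_integral_mono) (simp add: ennreal_mult[symmetric] cell_radius_nonneg y0 ennreal_leI)
    also have "\<dots> = ennreal (C * (M j * sqrt (measure P (I j)))) * lattice_sum TYPE('n)"
      unfolding N_def by (subst nn_integral_cmult) (simp_all add: lattice_sum_shift)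
    also have "\<dots> = ennreal (C * enn2real (lattice_sum TYPE('n)) * (M j * sqrt (measure P (I j))))"
      by (subst lat) (use C0 M0 in \<open>simp add: ennreal_mult[symmetric] ac_simps\<close>)
    finally show "(\<integral>\<^sup>+b. ennreal (cell_radius b) * ennreal (y j b) \<partial>count_space UNIV) \<le> \<dots>" .
  qed
  also have "\<dots> = ennreal (C * enn2real (lattice_sum TYPE('n)) * (\<Sum>j. M j * sqrt (measure P (I j))))"
  proof -
    have "0 \<le> M j" for j using M(2)[of j] by simp
    then show ?thesis
      using C0 summable by (subst suminf_ennreal2) (auto simp: suminf_mult intro: summable_mult)
  qed
  also have "C = 3 * CARD('n) * exp (2 * CARD('n) * (K + 1)) * sqrt V"
  proof -
    have "sqrt (exp (4 * d * (K + 1))) = exp (2 * d * (K + 1))"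
      by (rule real_sqrt_unique) (simp_all add: exp_double[symmetric] ac_simps)
    then show ?thesis
      by (simp add: C_def L_def real_sqrt_mult d_def)
  qed
  finally show ?thesis .
qed

text \<open>The hypothesis on \<Lambda> says that sqrt(s_k * 2^(k d)), the fluctuation after
  Cauchy-Schwarz, is at most \<Lambda> times 2^k. The side of the cubes cancels the 2^k, and every
  level costs a multiple of the same \<Lambda>.\<close>

lemma expected_wasserstein1_smoothed:
  fixes X :: "nat \<Rightarrow> 'w \<Rightarrow> real ^ 'n" and s :: "nat \<Rightarrow> real" and B \<Lambda> :: real
  assumes P: "prob_space P" "sets P = sets borel" and S: "prob_space S"
    and indep: "prob_space.indep_vars S (\<lambda>_. borel) X {..<n}"
    and law: "\<And>i. i < n \<Longrightarrow> distr S borel (X i) = P" and n: "0 < n"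
    and s: "\<And>k c x. shifted (dyadic_cell k -` {c}) x \<le> s k"
    and \<Lambda>: "\<And>k. s k * 2 ^ (k * CARD('n)) \<le> (\<Lambda> * 2 ^ k)\<^sup>2" "0 \<le> \<Lambda>"
    and B: "(\<integral>\<^sup>+b. ennreal (cell_radius b) * ennreal (sqrt (measure (P \<star> \<kappa>) (dyadic_cell 0 -` {b}))) \<partial>count_space UNIV)
      \<le> ennreal B" "0 \<le> B"
  shows "(\<integral>\<^sup>+\<omega>. wasserstein1 (empirical_measure n (\<lambda>i. X i \<omega>) \<star> \<kappa>) (P \<star> \<kappa>) \<partial>S)
    \<le> ennreal (CARD('n) / 2 ^ m + (2 * CARD('n) * m * \<Lambda> + 2) * B / sqrt n)"
proof -
  interpret S: prob_space S by fact
  interpret PK: prob_space "P \<star> \<kappa>" by (rule prob_space_smoothed[OF P])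
  define d where "d = real CARD('n)"
  define gap where "gap k c \<omega> = ennreal (cell_gap (empirical_measure n (\<lambda>i. X i \<omega>) \<star> \<kappa>) (P \<star> \<kappa>) k c)" for k c \<omega>
  define \<mu> where "\<mu> k c = measure (P \<star> \<kappa>) (dyadic_cell k -` {c})" for k c
  have X: "X i \<in> borel_measurable S" if "i < n" for i
    using indep that by (auto simp: S.indep_vars_def)
  have gap_meas[measurable]: "gap k c \<in> borel_measurable S" for k c
    unfolding gap_def cell_gap_def using X n
    by (intro borel_measurable_smoothed_deviation dyadic_cell_vimage_borel) auto
  have s0: "0 \<le> s k" for k
    using shifted_nonneg s[of k undefined undefined] order_trans by blast
  have gap_mean: "(\<integral>\<^sup>+\<omega>. gap k c \<omega> \<partial>S) \<le> ennreal (sqrt (t / n)) * ennreal (sqrt (\<mu> k c))"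
    if "\<And>x. shifted (dyadic_cell k -` {c}) x \<le> t" "0 \<le> t" for k c t
    using expected_smoothed_deviation[OF P S indep law n dyadic_cell_vimage_borel, of k c t] that
    by (simp add: gap_def cell_gap_def \<mu>_def ennreal_mult)
  \<comment> \<open>The weight \<open>cell_radius\<close> is at least 1, so the weighted bound also
    controls the unweighted sum.\<close>
  have base: "(\<integral>\<^sup>+b. ennreal (sqrt (\<mu> 0 b)) \<partial>count_space UNIV) \<le> ennreal B"
  proof -
    have "1 * ennreal (sqrt (\<mu> 0 b)) \<le> ennreal (cell_radius b) * ennreal (sqrt (\<mu> 0 b))" for b
      by (intro mult_right_mono) (auto simp: one_le_cell_radius)
    then show ?thesis
      using B(1) unfolding \<mu>_def by (intro order_trans[OF nn_integral_mono B(1)]) simp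
  qed
  have level: "(\<integral>\<^sup>+\<omega>. (\<integral>\<^sup>+c. gap k c \<omega> \<partial>count_space UNIV) \<partial>S) \<le> ennreal (\<Lambda> * 2 ^ k * B / sqrt n)" for k
  proof -
    have "(\<integral>\<^sup>+\<omega>. (\<integral>\<^sup>+c. gap k c \<omega> \<partial>count_space UNIV) \<partial>S) = (\<integral>\<^sup>+c. (\<integral>\<^sup>+\<omega>. gap k c \<omega> \<partial>S) \<partial>count_space UNIV)"
      by (rule nn_integral_count_space_nn_integral) auto
    also have "\<dots> \<le> (\<integral>\<^sup>+c. ennreal (sqrt (s k / n)) * ennreal (sqrt (\<mu> k c)) \<partial>count_space UNIV)"
      by (intro nn_integral_mono gap_mean s s0)
    also have "\<dots> = ennreal (sqrt (s k / n)) * (\<integral>\<^sup>+c. ennreal (sqrt (\<mu> k c)) \<partial>count_space UNIV)"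
      by (rule nn_integral_cmult) simp
    also have "\<dots> \<le> ennreal (sqrt (s k / n)) * (ennreal (sqrt (2 ^ (k * CARD('n)))) * ennreal B)"
      using sum_sqrt_children_le[OF PK.prob_space_axioms, of k] base
      unfolding \<mu>_def by (intro mult_left_mono) (auto elim!: order_trans intro!: mult_left_mono)
    also have "\<dots> = ennreal (sqrt (s k * 2 ^ (k * CARD('n))) * B / sqrt n)"
      using B(2) s0 by (simp add: ennreal_mult[symmetric] real_sqrt_mult real_sqrt_divide)
    also have "\<dots> \<le> ennreal (\<Lambda> * 2 ^ k * B / sqrt n)"
      using \<Lambda> B(2) by (intro ennreal_leI divide_right_mono mult_right_mono real_le_lsqrt) auto
    finally show ?thesis .
  qed
  have top: "(\<integral>\<^sup>+\<omega>. (\<integral>\<^sup>+c. ennreal (cell_radius c) * gap 0 c \<omega> \<partial>count_space UNIV) \<partial>S) \<le> ennreal (B / sqrt n)"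
  proof -
    have "(\<integral>\<^sup>+\<omega>. (\<integral>\<^sup>+c. ennreal (cell_radius c) * gap 0 c \<omega> \<partial>count_space UNIV) \<partial>S)
      = (\<integral>\<^sup>+c. (\<integral>\<^sup>+\<omega>. ennreal (cell_radius c) * gap 0 c \<omega> \<partial>S) \<partial>count_space UNIV)"
      by (rule nn_integral_count_space_nn_integral) auto
    also have "\<dots> \<le> (\<integral>\<^sup>+c. ennreal (1 / sqrt n) * (ennreal (cell_radius c) * ennreal (sqrt (\<mu> 0 c))) \<partial>count_space UNIV)"
    proof (intro nn_integral_mono)
      fix c
      \<comment> \<open>At the unit scale the trivial probability bound 1 suffices.\<close>
      have "(\<integral>\<^sup>+\<omega>. gap 0 c \<omega> \<partial>S) \<le> ennreal (1 / sqrt n) * ennreal (sqrt (\<mu> 0 c))"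
        using gap_mean[of 0 c 1] by (simp add: shifted_le_1 real_sqrt_divide)
      then show "(\<integral>\<^sup>+\<omega>. ennreal (cell_radius c) * gap 0 c \<omega> \<partial>S) \<le> ennreal (1 / sqrt n) * (ennreal (cell_radius c) * ennreal (sqrt (\<mu> 0 c)))"
        by (subst nn_integral_cmult) (auto simp: mult.left_commute intro: mult_left_mono)
    qed
    also have "\<dots> = ennreal (1 / sqrt n) * (\<integral>\<^sup>+c. ennreal (cell_radius c) * ennreal (sqrt (\<mu> 0 c)) \<partial>count_space UNIV)"
      by (rule nn_integral_cmult) simp
    also have "\<dots> \<le> ennreal (1 / sqrt n) * ennreal B"
      using B(1) unfolding \<mu>_def by (intro mult_left_mono) auto
    also have "\<dots> = ennreal (B / sqrt n)"
      using B(2) by (simp add: ennreal_mult[symmetric])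
    finally show ?thesis .
  qed
  have [measurable]: "(\<lambda>\<omega>. \<integral>\<^sup>+c. gap k c \<omega> \<partial>count_space UNIV) \<in> borel_measurable S"
    "(\<lambda>\<omega>. \<integral>\<^sup>+c. ennreal (cell_radius c) * gap k c \<omega> \<partial>count_space UNIV) \<in> borel_measurable S" for k
    by (rule borel_measurable_nn_integral_count_space; measurable)+
  \<comment> \<open>Monotonicity of the integral asks no measurability of the distance in \<omega>;
    only the bounding sums have to be measurable.\<close>
  have "(\<integral>\<^sup>+\<omega>. wasserstein1 (empirical_measure n (\<lambda>i. X i \<omega>) \<star> \<kappa>) (P \<star> \<kappa>) \<partial>S)
    \<le> (\<integral>\<^sup>+\<omega>. ennreal (d / 2 ^ m) + (\<Sum>i<m. ennreal (d / 2 ^ i) * (\<integral>\<^sup>+c. gap (Suc i) c \<omega> \<partial>count_space UNIV))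
      + 2 * (\<integral>\<^sup>+c. ennreal (cell_radius c) * gap 0 c \<omega> \<partial>count_space UNIV) \<partial>S)"
    unfolding gap_def d_def using n P PK.prob_space_axioms
    by (intro nn_integral_mono wasserstein1_le_cell_gaps prob_space_smoothed prob_space_empirical_measure) auto
  also have "\<dots> = ennreal (d / 2 ^ m) + (\<Sum>i<m. ennreal (d / 2 ^ i) * (\<integral>\<^sup>+\<omega>. (\<integral>\<^sup>+c. gap (Suc i) c \<omega> \<partial>count_space UNIV) \<partial>S))
      + 2 * (\<integral>\<^sup>+\<omega>. (\<integral>\<^sup>+c. ennreal (cell_radius c) * gap 0 c \<omega> \<partial>count_space UNIV) \<partial>S)"
    by (simp add: nn_integral_add nn_integral_sum nn_integral_cmult S.emeasure_space_1)
  also have "\<dots> \<le> ennreal (d / 2 ^ m) + (\<Sum>i<m. ennreal (d / 2 ^ i) * ennreal (\<Lambda> * 2 ^ Suc i * B / sqrt n)) + 2 * ennreal (B / sqrt n)"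
    by (intro add_mono sum_mono mult_left_mono level top order_refl) auto
  \<comment> \<open>Cost at scale \<open>i\<close> meets gaps at scale \<open>Suc i\<close>, so the
    powers of 2 leave a factor 2.\<close>
  also have "(\<Sum>i<m. ennreal (d / 2 ^ i) * ennreal (\<Lambda> * 2 ^ Suc i * B / sqrt n)) = (\<Sum>i<m. ennreal (2 * d * \<Lambda> * B / sqrt n))"
    using \<Lambda>(2) B(2) by (intro sum.cong refl) (simp add: ennreal_mult[symmetric] d_def field_simps)
  also have "\<dots> = ennreal (m * (2 * d * \<Lambda> * B / sqrt n))"
    using \<Lambda>(2) B(2) by (subst sum_ennreal) (simp_all add: d_def)
  also have "ennreal (d / 2 ^ m) + ennreal (m * (2 * d * \<Lambda> * B / sqrt n)) + 2 * ennreal (B / sqrt n)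
      = ennreal (d / 2 ^ m + m * (2 * d * \<Lambda> * B / sqrt n) + 2 * (B / sqrt n))"
  proof -
    have "2 * ennreal (B / sqrt n) = ennreal (2 * (B / sqrt n))"
      using B(2) by (subst ennreal_mult) auto
    then show ?thesis
      using \<Lambda>(2) B(2) by (simp add: d_def flip: ennreal_plus)
  qed
  also have "d / 2 ^ m + m * (2 * d * \<Lambda> * B / sqrt n) + 2 * (B / sqrt n) = d / 2 ^ m + (2 * d * m * \<Lambda> + 2) * B / sqrt n"
    using n by (simp add: field_simps)
  finally show ?thesis by (simp add: d_def)
qed

end

section \<open>Contraction of the distance under convolution\<close>

lemma wasserstein1_convolution_le:
  fixes P Q \<kappa> :: "(real ^ 'n) measure"
  assumes "prob_space P" "prob_space Q" "prob_space \<kappa>"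
    and sets: "sets P = sets borel" "sets Q = sets borel" "sets \<kappa> = sets borel"
  shows "wasserstein1 (P \<star> \<kappa>) (Q \<star> \<kappa>) \<le> wasserstein1 P Q"
  unfolding wasserstein1_def[of P Q]
proof (rule INF_greatest)
  fix \<pi> assume "\<pi> \<in> couplings P Q"
  then have \<pi>: "sets \<pi> = sets (P \<Otimes>\<^sub>M Q)" "distr \<pi> P fst = P" "distr \<pi> Q snd = Q"
    by (auto simp: couplings_def)
  interpret P: prob_space P by fact
  interpret K: prob_space \<kappa> by fact
  have sets_\<pi>[measurable_cong]: "sets \<pi> = sets (borel \<Otimes>\<^sub>M borel)"
    using \<pi>(1) sets by (simp cong: sets_pair_measure_cong)
  note [measurable_cong] = sets
  have "prob_space \<pi>"
  proof (rule prob_space_distrD)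
    show "fst \<in> \<pi> \<rightarrow>\<^sub>M P" by measurable
    show "prob_space (distr \<pi> P fst)" using \<pi>(2) assms(1) by simp
  qed
  then interpret \<pi>: prob_space \<pi> .
  \<comment> \<open>The same noise is added to both points of a coupled pair, which leaves their
    distance unchanged.\<close>
  define \<rho> where "\<rho> = distr (\<pi> \<Otimes>\<^sub>M \<kappa>) (borel \<Otimes>\<^sub>M borel) (\<lambda>w. (fst (fst w) + snd w, snd (fst w) + snd w))"
  have conv: "distr (\<pi> \<Otimes>\<^sub>M \<kappa>) borel (\<lambda>(p, z). f p + z) = (R \<star> \<kappa>)"
    if R: "distr \<pi> R f = R" "sets R = sets borel" and [measurable]: "f \<in> \<pi> \<rightarrow>\<^sub>M borel" for R f
  proof -
    have [measurable]: "f \<in> \<pi> \<rightarrow>\<^sub>M R" using that by (simp cong: measurable_cong_sets)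
    note [measurable_cong] = R(2)
    have "R \<Otimes>\<^sub>M \<kappa> = distr \<pi> R f \<Otimes>\<^sub>M distr \<kappa> \<kappa> (\<lambda>z. z)"
      by (simp add: R)
    also have "\<dots> = distr (\<pi> \<Otimes>\<^sub>M \<kappa>) (R \<Otimes>\<^sub>M \<kappa>) (\<lambda>(p, z). (f p, z))"
      by (rule pair_measure_distr) (auto intro: K.sigma_finite_measure_axioms)
    finally have RK: "R \<Otimes>\<^sub>M \<kappa> = distr (\<pi> \<Otimes>\<^sub>M \<kappa>) (R \<Otimes>\<^sub>M \<kappa>) (\<lambda>(p, z). (f p, z))" .
    show ?thesis
      unfolding convolution_def
      by (subst RK, subst distr_distr) (auto simp: comp_def case_prod_beta')
  qed
  have m: "(\<lambda>w. (fst (fst w) + snd w, snd (fst w) + snd w)) \<in> \<pi> \<Otimes>\<^sub>M \<kappa> \<rightarrow>\<^sub>M (borel \<Otimes>\<^sub>M borel :: ((real ^ 'n) \<times> (real ^ 'n)) measure)"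
    by measurable
  have "distr \<rho> (P \<star> \<kappa>) fst = (P \<star> \<kappa>)"
  proof -
    have "distr \<rho> (P \<star> \<kappa>) fst = distr \<rho> borel fst" by (intro distr_cong) auto
    also have "\<dots> = distr (\<pi> \<Otimes>\<^sub>M \<kappa>) borel (\<lambda>(p, z). fst p + z)"
      unfolding \<rho>_def by (subst distr_distr[OF _ m]) (auto simp: comp_def case_prod_beta')
    also have "\<dots> = (P \<star> \<kappa>)" using \<pi> sets by (intro conv) auto
    finally show ?thesis .
  qed
  moreover have "distr \<rho> (Q \<star> \<kappa>) snd = (Q \<star> \<kappa>)"
  proof -
    have "distr \<rho> (Q \<star> \<kappa>) snd = distr \<rho> borel snd" by (intro distr_cong) auto
    also have "\<dots> = distr (\<pi> \<Otimes>\<^sub>M \<kappa>) borel (\<lambda>(p, z). snd p + z)"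
      unfolding \<rho>_def by (subst distr_distr[OF _ m]) (auto simp: comp_def case_prod_beta')
    also have "\<dots> = (Q \<star> \<kappa>)" using \<pi> sets by (intro conv) auto
    finally show ?thesis .
  qed
  ultimately have "\<rho> \<in> couplings (P \<star> \<kappa>) (Q \<star> \<kappa>)"
    by (simp add: couplings_def \<rho>_def cong: sets_pair_measure_cong)
  moreover have "(\<integral>\<^sup>+(x, y). ennreal (dist x y) \<partial>\<rho>) = (\<integral>\<^sup>+(x, y). ennreal (dist x y) \<partial>\<pi>)"
  proof -
    have "(\<integral>\<^sup>+(x, y). ennreal (dist x y) \<partial>\<rho>) = (\<integral>\<^sup>+w. (case fst w of (x, y) \<Rightarrow> ennreal (dist x y)) \<partial>(\<pi> \<Otimes>\<^sub>M \<kappa>))"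
      unfolding \<rho>_def by (subst nn_integral_distr[OF m]) (auto simp: case_prod_beta' intro!: nn_integral_cong)
    also have "\<dots> = (\<integral>\<^sup>+(x, y). ennreal (dist x y) \<partial>\<pi>)"
      by (subst K.nn_integral_fst[symmetric]) (auto simp: K.emeasure_space_1)
    finally show ?thesis .
  qed
  ultimately show "wasserstein1 (P \<star> \<kappa>) (Q \<star> \<kappa>) \<le> (\<integral>\<^sup>+(x, y). ennreal (dist x y) \<partial>\<pi>)"
    unfolding wasserstein1_def by (metis INF_lower)
qed

lemma convolution_return_0:
  assumes "prob_space P" "sets P = sets borel"
  shows "(P \<star> return borel 0) = P"
proof (rule measure_eqI)
  fix A assume "A \<in> sets (P \<star> return borel 0)"
  then have A[measurable]: "A \<in> sets borel" by simp
  interpret P: prob_space P by fact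
  interpret R: prob_space "return borel (0::'a)" by (rule prob_space_return) simp
  have "emeasure (P \<star> return borel 0) A = (\<integral>\<^sup>+x. \<integral>\<^sup>+y. indicator A (x + y) \<partial>return borel 0 \<partial>P)"
    using assms P.finite_measure_axioms R.finite_measure_axioms by (intro convolution_emeasure') auto
  also have "\<dots> = (\<integral>\<^sup>+x. indicator A x \<partial>P)"
    by (intro nn_integral_cong) (subst nn_integral_return, auto)
  finally show "emeasure (P \<star> return borel 0) A = emeasure P A"
    using assms A by simp
qed (use assms in simp)

section \<open>Gaussian noise\<close>

text \<open>Coordinates are inner products with the vectors \<open>axis i 1\<close>, so the product
  over indices is the product over \<open>Basis\<close> to which Fubini applies.\<close>

lemma nn_integral_lborel_vec_prod:
  assumes [measurable]: "f \<in> borel_measurable (borel :: real measure)"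
  shows "(\<integral>\<^sup>+x. (\<Prod>i\<in>UNIV. f (x $ i)) \<partial>(lborel :: (real ^ 'n) measure)) = (\<integral>\<^sup>+t. f t \<partial>lborel) ^ CARD('n)"
proof -
  have Basis: "(Basis :: (real ^ 'n) set) = range (\<lambda>i. axis i 1)"
    by (auto simp: Basis_vec_def)
  have inj: "inj (\<lambda>i::'n. axis i (1::real))"
    by (auto intro!: injI simp: axis_eq_axis)
  have "(\<Prod>i\<in>UNIV. f (x $ i)) = (\<Prod>b\<in>Basis. f (x \<bullet> b))" for x :: "real ^ 'n"
    unfolding Basis by (subst prod.reindex[OF inj]) (simp add: inner_axis)
  then show ?thesis
    using nn_integral_lborel_prod[where f = "\<lambda>_ :: real ^ 'n. f"] by simp
qed

lemma emeasure_cube: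
  fixes a :: "real ^ 'n"
  assumes "0 \<le> h"
  shows "emeasure lborel (cbox a (a + (\<chi> i. h))) = ennreal (h ^ CARD('n))"
proof -
  have "b \<in> Basis \<Longrightarrow> ((\<chi> i. h) :: real ^ 'n) \<bullet> b = h" for b
    by (auto simp: Basis_vec_def inner_axis)
  then show ?thesis
    using assms by (simp add: emeasure_lborel_cbox_eq inner_add_left)
qed

lemma nn_integral_normal_density: "0 < \<sigma> \<Longrightarrow> (\<integral>\<^sup>+t. ennreal (normal_density \<mu> \<sigma> t) \<partial>lborel) = 1"
  by (subst nn_integral_eq_integral) auto

text \<open>Completing the square: exponential tilting moves the mean of a Gaussian and keeps its
  variance.\<close>

lemma normal_density_exp:
  assumes "0 < \<sigma>"
  shows "normal_density 0 \<sigma> t * exp (l * t) = exp (l\<^sup>2 * \<sigma>\<^sup>2 / 2) * normal_density (l * \<sigma>\<^sup>2) \<sigma> t"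
proof -
  have "- (t - 0)\<^sup>2 / (2 * \<sigma>\<^sup>2) + l * t = l\<^sup>2 * \<sigma>\<^sup>2 / 2 + - (t - l * \<sigma>\<^sup>2)\<^sup>2 / (2 * \<sigma>\<^sup>2)"
    using assms by (simp add: field_simps power2_eq_square)
  then have "exp (- (t - 0)\<^sup>2 / (2 * \<sigma>\<^sup>2)) * exp (l * t) = exp (l\<^sup>2 * \<sigma>\<^sup>2 / 2) * exp (- (t - l * \<sigma>\<^sup>2)\<^sup>2 / (2 * \<sigma>\<^sup>2))"
    by (simp only: exp_add[symmetric])
  then show ?thesis
    by (simp add: normal_density_def)
qed

text \<open>The exponential of 4|t| is at most the sum of those of 4t and -4t, and tilting by 4 or
  -4 costs exp(16 \<sigma>^2 / 2).\<close>

lemma nn_integral_normal_exp_abs: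
  assumes "0 < \<sigma>"
  shows "(\<integral>\<^sup>+t. ennreal (normal_density 0 \<sigma> t * exp (4 * \<bar>t\<bar>)) \<partial>lborel) \<le> ennreal (2 * exp (8 * \<sigma>\<^sup>2))"
proof -
  have "normal_density 0 \<sigma> t * exp (4 * \<bar>t\<bar>)
      \<le> exp (8 * \<sigma>\<^sup>2) * normal_density (4 * \<sigma>\<^sup>2) \<sigma> t + exp (8 * \<sigma>\<^sup>2) * normal_density (- 4 * \<sigma>\<^sup>2) \<sigma> t" for t
  proof -
    have "normal_density 0 \<sigma> t * exp (4 * \<bar>t\<bar>) \<le> normal_density 0 \<sigma> t * exp (4 * t) + normal_density 0 \<sigma> t * exp (- 4 * t)"
      by (cases "0 \<le> t") (auto simp: abs_if)
    then show ?thesis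
      using normal_density_exp[OF assms, of t 4] normal_density_exp[OF assms, of t "- 4"] by simp
  qed
  then have "(\<integral>\<^sup>+t. ennreal (normal_density 0 \<sigma> t * exp (4 * \<bar>t\<bar>)) \<partial>lborel)
    \<le> (\<integral>\<^sup>+t. ennreal (exp (8 * \<sigma>\<^sup>2)) * ennreal (normal_density (4 * \<sigma>\<^sup>2) \<sigma> t)
        + ennreal (exp (8 * \<sigma>\<^sup>2)) * ennreal (normal_density (- 4 * \<sigma>\<^sup>2) \<sigma> t) \<partial>lborel)"
    by (intro nn_integral_mono) (simp add: ennreal_leI flip: ennreal_mult ennreal_plus)
  also have "\<dots> = ennreal (exp (8 * \<sigma>\<^sup>2)) + ennreal (exp (8 * \<sigma>\<^sup>2))"
    using assms by (simp add: nn_integral_add nn_integral_cmult nn_integral_normal_density)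
  finally show ?thesis by (simp flip: ennreal_plus)
qed

lemma isotropic_gaussian_eq:
  "isotropic_gaussian \<sigma> = density lborel (\<lambda>x::real ^ 'n. \<Prod>i\<in>UNIV. ennreal (normal_density 0 \<sigma> (x $ i)))"
  by (simp add: isotropic_gaussian_def prod_ennreal)

lemma borel_measurable_gaussian_density:
  "(\<lambda>x::real ^ 'n. \<Prod>i\<in>UNIV. ennreal (normal_density 0 \<sigma> (x $ i))) \<in> borel_measurable borel"
proof -
  note [measurable] = borel_measurable_vec_nth
  show ?thesis by measurable
qed

lemma smoothing_kernel_gaussian:
  assumes "0 < \<sigma>" shows "smoothing_kernel (isotropic_gaussian \<sigma> :: (real ^ 'n) measure)"
proof -
  note [measurable] = borel_measurable_gaussian_density
  have "emeasure (isotropic_gaussian \<sigma> :: (real ^ 'n) measure) (space (isotropic_gaussian \<sigma>)) = 1"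
    using nn_integral_lborel_vec_prod[of "\<lambda>t. ennreal (normal_density 0 \<sigma> t)", where 'n='n] assms
    by (simp add: isotropic_gaussian_eq emeasure_density nn_integral_normal_density)
  then interpret prob_space "isotropic_gaussian \<sigma> :: (real ^ 'n) measure"
    by (rule prob_spaceI)
  show ?thesis by unfold_locales (simp add: isotropic_gaussian_eq)
qed

lemma gaussian_exp_moment:
  assumes "0 < \<sigma>"
  shows "(\<integral>\<^sup>+z. ennreal (exp (4 * (\<Sum>i\<in>UNIV. \<bar>z $ i\<bar>))) \<partial>(isotropic_gaussian \<sigma> :: (real ^ 'n) measure))
    \<le> ennreal ((2 * exp (8 * \<sigma>\<^sup>2)) ^ CARD('n))"
proof -
  note [measurable] = borel_measurable_gaussian_density borel_measurable_vec_nth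
  have "(\<integral>\<^sup>+z. ennreal (exp (4 * (\<Sum>i\<in>UNIV. \<bar>z $ i\<bar>))) \<partial>(isotropic_gaussian \<sigma> :: (real ^ 'n) measure))
    = (\<integral>\<^sup>+z. (\<Prod>i\<in>UNIV. ennreal (normal_density 0 \<sigma> (z $ i))) * ennreal (exp (4 * (\<Sum>i\<in>UNIV. \<bar>z $ i\<bar>))) \<partial>(lborel :: (real ^ 'n) measure))"
    unfolding isotropic_gaussian_eq by (subst nn_integral_density) auto
  also have "\<dots> = (\<integral>\<^sup>+z. (\<Prod>i\<in>UNIV. ennreal (normal_density 0 \<sigma> (z $ i) * exp (4 * \<bar>z $ i\<bar>))) \<partial>(lborel :: (real ^ 'n) measure))"
    by (intro nn_integral_cong)
      (simp add: sum_distrib_left exp_sum prod_ennreal prod_nonneg prod.distrib flip: ennreal_mult)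
  also have "\<dots> = (\<integral>\<^sup>+t. ennreal (normal_density 0 \<sigma> t * exp (4 * \<bar>t\<bar>)) \<partial>lborel) ^ CARD('n)"
    by (rule nn_integral_lborel_vec_prod) measurable
  also have "\<dots> \<le> ennreal (2 * exp (8 * \<sigma>\<^sup>2)) ^ CARD('n)"
    by (intro power_mono nn_integral_normal_exp_abs assms) simp
  finally show ?thesis by (simp add: ennreal_power)
qed

text \<open>The volume of the cell times the maximum of the density, where the factor (2 pi)^(-d/2)
  is estimated by 1.\<close>

lemma gaussian_cell_le:
  assumes "0 < \<sigma>"
  shows "measure (isotropic_gaussian \<sigma> :: (real ^ 'n) measure) {z. x + z \<in> dyadic_cell k -` {c}}
    \<le> 1 / (2 ^ k * \<sigma>) ^ CARD('n)"
proof -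
  interpret smoothing_kernel "isotropic_gaussian \<sigma> :: (real ^ 'n) measure"
    by (rule smoothing_kernel_gaussian[OF assms])
  note [measurable] = borel_measurable_gaussian_density
  define A where "A = {z. x + z \<in> dyadic_cell k -` {c}}"
  define a :: "real ^ 'n" where "a = (\<chi> i. c $ i / 2 ^ k - x $ i)"
  have A[measurable]: "A \<in> sets borel"
    unfolding A_def by (intro sets_shift dyadic_cell_vimage_borel)
  have "normal_density 0 \<sigma> t \<le> 1 / \<sigma>" for t
  proof -
    have "\<sigma> \<le> sqrt (2 * pi * \<sigma>\<^sup>2)"
      using assms pi_gt3 by (intro real_le_rsqrt) simp
    then have "1 / sqrt (2 * pi * \<sigma>\<^sup>2) \<le> 1 / \<sigma>"
      using assms by (intro divide_left_mono) auto
    then have "1 / sqrt (2 * pi * \<sigma>\<^sup>2) * exp (- (t - 0)\<^sup>2 / (2 * \<sigma>\<^sup>2)) \<le> 1 / \<sigma> * 1"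
      using assms by (intro mult_mono) auto
    then show ?thesis by (simp add: normal_density_def)
  qed
  then have dens: "(\<Prod>i\<in>UNIV. ennreal (normal_density 0 \<sigma> (z $ i))) \<le> ennreal ((1 / \<sigma>) ^ CARD('n))" for z :: "real ^ 'n"
    unfolding prod_ennreal[OF normal_density_nonneg]
    using prod_mono[of UNIV "\<lambda>i. normal_density 0 \<sigma> (z $ i)" "\<lambda>_. 1 / \<sigma>"]
    by (intro ennreal_leI) simp
  have "emeasure (isotropic_gaussian \<sigma>) A = (\<integral>\<^sup>+z. (\<Prod>i\<in>UNIV. ennreal (normal_density 0 \<sigma> (z $ i))) * indicator A z \<partial>lborel)"
    by (simp add: isotropic_gaussian_eq emeasure_density)
  also have "\<dots> \<le> (\<integral>\<^sup>+z. ennreal ((1 / \<sigma>) ^ CARD('n)) * indicator A z \<partial>lborel)"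
    by (intro nn_integral_mono mult_right_mono dens) simp
  also have "\<dots> = ennreal ((1 / \<sigma>) ^ CARD('n)) * emeasure lborel A"
    by (simp add: nn_integral_cmult_indicator)
  also have "\<dots> \<le> ennreal ((1 / \<sigma>) ^ CARD('n)) * emeasure lborel (cbox a (a + (\<chi> i. 1 / 2 ^ k)))"
  proof (intro mult_left_mono emeasure_mono subsetI)
    fix z assume "z \<in> A"
    then have "c $ i \<le> 2 ^ k * (x $ i + z $ i) \<and> 2 ^ k * (x $ i + z $ i) < c $ i + 1" for i
      by (simp add: A_def dyadic_cell_eq_iff)
    then have "c $ i / 2 ^ k \<le> x $ i + z $ i \<and> x $ i + z $ i \<le> c $ i / 2 ^ k + 1 / 2 ^ k" for i
      by (simp add: field_simps less_imp_le)
    then show "z \<in> cbox a (a + (\<chi> i. 1 / 2 ^ k))"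
      by (simp add: mem_box_cart a_def algebra_simps)
  qed auto
  also have "\<dots> = ennreal (1 / (2 ^ k * \<sigma>) ^ CARD('n))"
    using assms by (simp add: emeasure_cube ennreal_mult[symmetric] power_mult_distrib power_divide)
  finally show ?thesis
    using assms unfolding A_def emeasure_eq_measure by (simp add: ennreal_le_iff)
qed

lemma smoothing_kernel_return: "smoothing_kernel (return borel 0 :: (real ^ 'n) measure)"
proof -
  interpret prob_space "return borel 0 :: (real ^ 'n) measure"
    by (rule prob_space_return) simp
  show ?thesis by unfold_locales simp
qed

text \<open>
  A cell of side \<open>2 ^ -k\<close> has noise probability at most \<open>1\<close> and at most its volume divided by
  \<open>\<sigma> ^ d\<close>. The first bound is used above scale \<open>\<sigma>\<close>, the second below it.
\<close>

lemma gaussian_scale_balance: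
  fixes \<sigma> :: real
  assumes "0 < \<sigma>" "2 \<le> d"
  shows "min 1 (1 / (2 ^ k * \<sigma>) ^ d) * 2 ^ (k * d) \<le> (\<sigma> powr (- real d / 2 + 1) * 2 ^ k)\<^sup>2"
proof -
  define u where "u = 2 ^ k * \<sigma>"
  have u: "0 < u" using assms by (simp add: u_def)
  \<comment> \<open>The square of \<sigma>^(1 - d/2) is \<sigma>^(-(d - 2)); writing d = e + 2 turns
    it into a natural power.\<close>
  obtain e where d: "d = e + 2" using assms(2) by (metis add.commute le_Suc_ex)
  have "(\<sigma> powr (- real d / 2 + 1))\<^sup>2 = \<sigma> powr (- real e)"
    by (simp add: powr_realpow[symmetric] powr_powr power2_eq_square powr_add[symmetric] d)
  also have "\<dots> = 1 / \<sigma> ^ e"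
    using assms by (simp add: powr_minus powr_realpow divide_inverse)
  finally have R: "(\<sigma> powr (- real d / 2 + 1) * 2 ^ k)\<^sup>2 = (2 ^ k)\<^sup>2 / \<sigma> ^ e"
    by (simp add: power_mult_distrib)
  have E: "2 ^ (k * d) = (2 ^ k) ^ e * ((2::real) ^ k)\<^sup>2"
    by (simp add: d power_mult power_add power2_eq_square)
  \<comment> \<open>This is the whole claim in terms of the ratio \<open>u\<close> of \<sigma> to
    the side of the cells. For u > 1 the product is 1 / u^2.\<close>
  have "min 1 (1 / u ^ d) * u ^ e \<le> 1"
  proof (cases "u \<le> 1")
    case True
    have "min 1 (1 / u ^ d) * u ^ e \<le> 1 * 1"
      using u True by (intro mult_mono) (auto simp: power_le_one)
    then show ?thesis by simp
  next
    case False
    have "min 1 (1 / u ^ d) * u ^ e \<le> (1 / u ^ d) * u ^ e"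
      using u by (intro mult_right_mono) auto
    also have "\<dots> = 1 / u\<^sup>2" using u by (simp add: d power_add power2_eq_square)
    also have "\<dots> \<le> 1" using False by (simp add: one_le_power)
    finally show ?thesis .
  qed
  then have "min 1 (1 / u ^ d) * (2 ^ k) ^ e * \<sigma> ^ e \<le> 1"
    by (simp add: u_def power_mult_distrib mult.assoc)
  then have "min 1 (1 / u ^ d) * (2 ^ k) ^ e \<le> 1 / \<sigma> ^ e"
    using assms by (simp add: field_simps)
  then have "min 1 (1 / u ^ d) * (2 ^ k) ^ e * (2 ^ k)\<^sup>2 \<le> 1 / \<sigma> ^ e * (2 ^ k)\<^sup>2"
    by (rule mult_right_mono) simp
  then show ?thesis
    unfolding R E by (simp add: u_def ac_simps)
qed

section \<open>The rate\<close>

text \<open>The terms without the factor \<open>D * ln n * W\<close> are absorbed by means of 1 <=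
  (D / c) * L * W, where each of the three factors is at least 1. This is where the constant comes
  to depend on \<open>c\<close>. The choice of \<open>m\<close> gives 2^m >= n >= sqrt n, so the
  finest cubes cost no more than the rate.\<close>

lemma multiscale_rate_le:
  fixes c D d W C \<Lambda> :: real
  assumes c: "0 < c" "c \<le> D" and d: "0 \<le> d" and n: "2 \<le> n" and W: "1 \<le> W" and C: "0 \<le> C"
    and \<Lambda>: "\<Lambda> \<le> (1 + 1 / c) * D"
  defines "m \<equiv> nat \<lceil>log 2 (real n)\<rceil>"
  shows "d / 2 ^ m + (2 * d * m * \<Lambda> + 2) * (C * W) / sqrt n
    \<le> (d / c + 4 * d * (1 + 1 / c) * C + 2 * C / c) / ln 2 * (D * ln n / sqrt n * W)"
proof -
  define L where "L = ln (real n) / ln 2"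
  \<comment> \<open>Here n >= 2 is essential; it also lets the rounding up in \<open>m\<close> be
    paid for by a factor 2.\<close>
  have L: "1 \<le> L" using n by (simp add: L_def)
  have log: "log 2 (real n) = L" by (simp add: L_def log_def)
  have mL: "L \<le> m" "real m \<le> 2 * L"
    using L unfolding m_def log by linarith+
  have D0: "0 < D" using c by simp
  have Dc: "1 \<le> D / c" using c by simp
  have DL: "1 \<le> D / c * L"
    using mult_mono[OF Dc L] Dc by simp
  have DLW: "1 \<le> D / c * L * W"
    using mult_mono[OF DL W] DL by simp
  have "real n = 2 powr L"
    using n powr_log_cancel[of 2 "real n"] by (simp add: log)
  also have "\<dots> \<le> 2 powr m" using mL by simp
  finally have "real n \<le> 2 ^ m" by (simp add: powr_realpow)
  moreover have "sqrt n \<le> n"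
    using n by (intro real_le_lsqrt) (auto simp: power2_eq_square)
  ultimately have "sqrt n \<le> 2 ^ m" by (rule order_trans[rotated])
  then have "d / 2 ^ m \<le> d / sqrt n"
    using d n by (intro divide_left_mono) auto
  then have "d / 2 ^ m + (2 * d * m * \<Lambda> + 2) * (C * W) / sqrt n
    \<le> (d + (2 * d * m * \<Lambda> + 2) * (C * W)) / sqrt n"
    by (simp add: add_divide_distrib)
  also have "\<dots> \<le> ((d / c + 4 * d * (1 + 1 / c) * C + 2 * C / c) * (D * L * W)) / sqrt n"
  proof (rule divide_right_mono)
    have 1: "d \<le> d / c * (D * L * W)"
      using mult_left_mono[OF DLW d] by (simp add: ac_simps)
    have "real m * \<Lambda> \<le> real m * ((1 + 1 / c) * D)"
      using \<Lambda> by (intro mult_left_mono) auto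
    also have "\<dots> \<le> 2 * L * ((1 + 1 / c) * D)"
      using mL c D0 by (intro mult_right_mono) auto
    finally have "2 * d * (real m * \<Lambda>) * (C * W) \<le> 2 * d * (2 * L * ((1 + 1 / c) * D)) * (C * W)"
      using d C W by (intro mult_right_mono mult_left_mono) auto
    then have 2: "2 * d * m * \<Lambda> * (C * W) \<le> 4 * d * (1 + 1 / c) * C * (D * L * W)"
      by (simp add: ac_simps)
    have "2 * (C * W) * 1 \<le> 2 * (C * W) * (D / c * L)"
      using DL C W by (intro mult_left_mono) auto
    then have 3: "2 * (C * W) \<le> 2 * C / c * (D * L * W)"
      by (simp add: ac_simps)
    show "d + (2 * d * m * \<Lambda> + 2) * (C * W) \<le> (d / c + 4 * d * (1 + 1 / c) * C + 2 * C / c) * (D * L * W)"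
      unfolding distrib_right using 1 2 3 by linarith
  qed simp
  also have "\<dots> = (d / c + 4 * d * (1 + 1 / c) * C + 2 * C / c) / ln 2 * (D * ln n / sqrt n * W)"
    by (simp add: L_def)
  finally show ?thesis .
qed

text \<open>The upper bound on \<Lambda> is shaped to admit both later choices: \<Lambda> = D for
  Gaussian noise, and \<Lambda> = 1 without noise, as 1 <= D / c.\<close>

lemma (in smoothing_kernel) expected_wasserstein1_partition:
  fixes X :: "nat \<Rightarrow> 'w \<Rightarrow> real ^ 'n" and s :: "nat \<Rightarrow> real" and I :: "nat \<Rightarrow> (real ^ 'n) set"
    and K V c D \<Lambda> :: real and M :: "nat \<Rightarrow> real"
  assumes P: "prob_space P" "sets P = sets borel"
    and I: "(\<Union>j. I j) = UNIV" "disjoint_family I" "\<And>j. I j \<in> sets borel" "\<And>j. I j \<noteq> {}"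
    and K: "\<And>j x y. x \<in> I j \<Longrightarrow> y \<in> I j \<Longrightarrow> dist x y \<le> K"
    and M: "\<And>j x. x \<in> I j \<Longrightarrow> norm x \<le> M j" "\<And>j. 1 \<le> M j"
    and summable: "summable (\<lambda>j. M j * sqrt (measure P (I j)))"
    and V: "(\<integral>\<^sup>+z. ennreal (exp (4 * (\<Sum>i\<in>UNIV. \<bar>z $ i\<bar>))) \<partial>\<kappa>) \<le> ennreal V" "0 \<le> V"
    and S: "prob_space S" and indep: "prob_space.indep_vars S (\<lambda>_. borel) X {..<n}"
    and law: "\<And>i. i < n \<Longrightarrow> distr S borel (X i) = P" and n: "2 \<le> n"
    and s: "\<And>k c x. shifted (dyadic_cell k -` {c}) x \<le> s k"
    and \<Lambda>: "\<And>k. s k * 2 ^ (k * CARD('n)) \<le> (\<Lambda> * 2 ^ k)\<^sup>2" "0 \<le> \<Lambda>" "\<Lambda> \<le> (1 + 1 / c) * D"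
    and c: "0 < c" "c \<le> D"
  defines "C \<equiv> 3 * CARD('n) * exp (2 * CARD('n) * (K + 1)) * sqrt V * enn2real (lattice_sum TYPE('n))"
  shows "(\<integral>\<^sup>+\<omega>. wasserstein1 (empirical_measure n (\<lambda>i. X i \<omega>) \<star> \<kappa>) (P \<star> \<kappa>) \<partial>S)
    \<le> ennreal ((CARD('n) / c + 4 * CARD('n) * (1 + 1 / c) * C + 2 * C / c) / ln 2
        * (D * ln n / sqrt n * (\<Sum>j. M j * sqrt (measure P (I j)))))"
proof -
  interpret P: prob_space P by fact
  define W where "W = (\<Sum>j. M j * sqrt (measure P (I j)))"
  define m where "m = nat \<lceil>log 2 (real n)\<rceil>"
  have C: "0 \<le> C" using V(2) by (simp add: C_def)
  have "(\<lambda>j. measure P (I j)) sums measure P (\<Union>j. I j)"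
    using I P(2) by (intro P.finite_measure_UNION) auto
  moreover have "measure P (\<Union>j. I j) = 1"
    using P.prob_space sets_eq_imp_space_eq[OF P(2)] by (simp add: I(1))
  ultimately have one: "(\<lambda>j. measure P (I j)) sums 1" by simp
  \<comment> \<open>A probability is at most its square root and \<open>M j\<close> is at least 1;
    summing over the partition gives \<open>W\<close> at least 1.\<close>
  have "measure P (I j) \<le> M j * sqrt (measure P (I j))" for j
  proof -
    have "measure P (I j) \<le> sqrt (measure P (I j))"
      by (intro real_le_rsqrt) (simp add: power2_eq_square mult_left_le)
    also have "\<dots> \<le> M j * sqrt (measure P (I j))"
      using M(2)[of j] mult_right_mono[of 1 "M j" "sqrt (measure P (I j))"] by simp
    finally show ?thesis .
  qed
  from suminf_le[OF this sums_summable[OF one] summable] have W: "1 \<le> W"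
    unfolding W_def sums_unique[OF one, symmetric] .
  have "(\<integral>\<^sup>+\<omega>. wasserstein1 (empirical_measure n (\<lambda>i. X i \<omega>) \<star> \<kappa>) (P \<star> \<kappa>) \<partial>S)
    \<le> ennreal (CARD('n) / 2 ^ m + (2 * CARD('n) * m * \<Lambda> + 2) * (C * W) / sqrt n)"
    unfolding C_def W_def
    by (rule expected_wasserstein1_smoothed[OF P S indep law _ s \<Lambda>(1,2)
          weighted_sqrt_cells_le[OF P I K M summable V]])
      (use n C W in \<open>auto simp: C_def W_def\<close>)
  also have "\<dots> \<le> ennreal ((CARD('n) / c + 4 * CARD('n) * (1 + 1 / c) * C + 2 * C / c) / ln 2
        * (D * ln n / sqrt n * W))"
    using multiscale_rate_le[OF c _ n W C \<Lambda>(3), of "real CARD('n)"]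
    by (intro ennreal_leI) (simp add: m_def)
  finally show ?thesis by (simp add: W_def)
qed

text \<open>\<open>C\<close> is chosen after \<open>K\<close>, \<open>c\<close> and the dimension
  but before \<sigma>, the partition, the law and the sample. The sets are required to be Borel
  because convexity does not imply it: in dimension at least 2 an arbitrary part of the sphere may
  be added to an open ball. For n = 1 the logarithm vanishes, hence n >= 2.\<close>

theorem corollary1:
  fixes K c :: real
  assumes "c > 0"
  shows "\<exists>C::real.
    \<forall>(\<sigma>::real) (I :: nat \<Rightarrow> (real ^ 'n) set) (P :: (real ^ 'n) measure)
      (S :: 'w measure) (X :: nat \<Rightarrow> 'w \<Rightarrow> real ^ 'n) (n::nat).
      \<sigma> > 0 \<and> \<sigma> powr (- real CARD('n) / 2 + 1) \<ge> c \<and>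
      (\<Union>j. I j) = UNIV \<and> disjoint_family I \<and>
      (\<forall>j. bounded (I j) \<and> convex (I j) \<and> interior (I j) \<noteq> {} \<and> I j \<in> sets borel) \<and>
      bdd_above (range (\<lambda>j. diameter (I j))) \<and> K = (SUP j. diameter (I j)) \<and>
      (\<forall>j. (SUP x\<in>I j. norm x) \<ge> 1) \<and>
      prob_space P \<and> sets P = sets borel \<and> integrable P (\<lambda>x. (norm x)\<^sup>2) \<and>
      summable (\<lambda>j. (SUP x\<in>I j. norm x) * sqrt (measure P (I j))) \<and>
      n \<ge> 2 \<and> prob_space S \<and> prob_space.indep_vars S (\<lambda>_. borel) X {..<n} \<and>
      (\<forall>i<n. distr S borel (X i) = P)
      \<longrightarrow>
      (\<integral>\<^sup>+ \<omega>. smooth_wasserstein1 \<sigma> (empirical_measure n (\<lambda>i. X i \<omega>)) P \<partial>S)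
        \<le> ennreal (C * (\<sigma> powr (- real CARD('n) / 2 + 1) * ln (real n) / sqrt (real n)
            * (\<Sum>j. (SUP x\<in>I j. norm x) * sqrt (measure P (I j)))))"
proof -
  \<comment> \<open>For d >= 3 this is the \<sigma> at which \<sigma>^(1 - d/2) equals
    \<open>c\<close>, hence the largest one allowed. For d = 2 the exponent is
    \<open>1 / 0 = 0\<close>; this is harmless, as for d <= 2 only \<open>V1\<close> is used, the
    exponential moment of the point mass at 0 being 1.\<close>
  define \<sigma>\<^sub>0 where "\<sigma>\<^sub>0 = c powr (1 / (- real CARD('n) / 2 + 1))"
  define V where "V = (2 * exp (8 * \<sigma>\<^sub>0\<^sup>2)) ^ CARD('n)"
  have V1: "1 \<le> V"
  proof -
    have "1 * 1 \<le> 2 * exp (8 * \<sigma>\<^sub>0\<^sup>2)" by (intro mult_mono) auto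
    then show ?thesis unfolding V_def by (intro one_le_power) simp
  qed
  then have V0: "0 \<le> V" by simp
  define C where "C = 3 * CARD('n) * exp (2 * CARD('n) * (K + 1)) * sqrt V * enn2real (lattice_sum TYPE('n))"
  show ?thesis
  proof (intro exI[of _ "(CARD('n) / c + 4 * CARD('n) * (1 + 1 / c) * C + 2 * C / c) / ln 2"] allI impI)
    fix \<sigma> :: real and I :: "nat \<Rightarrow> (real ^ 'n) set" and P :: "(real ^ 'n) measure"
      and S :: "'w measure" and X :: "nat \<Rightarrow> 'w \<Rightarrow> real ^ 'n" and n :: nat
    assume H: "\<sigma> > 0 \<and> \<sigma> powr (- real CARD('n) / 2 + 1) \<ge> c \<and>
      (\<Union>j. I j) = UNIV \<and> disjoint_family I \<and>
      (\<forall>j. bounded (I j) \<and> convex (I j) \<and> interior (I j) \<noteq> {} \<and> I j \<in> sets borel) \<and>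
      bdd_above (range (\<lambda>j. diameter (I j))) \<and> K = (SUP j. diameter (I j)) \<and>
      (\<forall>j. (SUP x\<in>I j. norm x) \<ge> 1) \<and>
      prob_space P \<and> sets P = sets borel \<and> integrable P (\<lambda>x. (norm x)\<^sup>2) \<and>
      summable (\<lambda>j. (SUP x\<in>I j. norm x) * sqrt (measure P (I j))) \<and>
      n \<ge> 2 \<and> prob_space S \<and> prob_space.indep_vars S (\<lambda>_. borel) X {..<n} \<and>
      (\<forall>i<n. distr S borel (X i) = P)"
    define M where "M j = (SUP x\<in>I j. norm x)" for j
    define D where "D = \<sigma> powr (- real CARD('n) / 2 + 1)"
    have \<sigma>: "0 < \<sigma>" and D: "c \<le> D" and P: "prob_space P" "sets P = sets borel"
      and I: "(\<Union>j. I j) = UNIV" "disjoint_family I" "\<And>j. I j \<in> sets borel"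
      and bdd: "\<And>j. bounded (I j)"
      and S: "prob_space S" "prob_space.indep_vars S (\<lambda>_. borel) X {..<n}"
        "\<And>i. i < n \<Longrightarrow> distr S borel (X i) = P" and n: "2 \<le> n"
      and summable: "summable (\<lambda>j. M j * sqrt (measure P (I j)))" and M1: "\<And>j. 1 \<le> M j"
      using H by (auto simp: D_def M_def)
    have ne: "I j \<noteq> {}" for j
    proof
      assume "I j = {}"
      then have "interior (I j) = {}" by simp
      with H show False by blast
    qed
    have K: "dist x y \<le> K" if "x \<in> I j" "y \<in> I j" for x y j
    proof -
      have "dist x y \<le> diameter (I j)" by (rule diameter_bounded_bound[OF bdd that])
      also have "\<dots> \<le> (SUP j. diameter (I j))" using H by (intro cSUP_upper) auto
      finally show ?thesis using H by simp
    qed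
    have M: "norm x \<le> M j" if "x \<in> I j" for x j
      unfolding M_def using bdd[of j] that
      by (intro cSUP_upper) (auto simp: bounded_iff bdd_above_def)
    have prob_emp: "prob_space (empirical_measure n x)" for x :: "nat \<Rightarrow> real ^ 'n"
      using n by (intro prob_space_empirical_measure) auto
    let ?rhs = "ennreal ((CARD('n) / c + 4 * CARD('n) * (1 + 1 / c) * C + 2 * C / c) / ln 2
        * (D * ln n / sqrt n * (\<Sum>j. M j * sqrt (measure P (I j)))))"
    have "(\<integral>\<^sup>+\<omega>. smooth_wasserstein1 \<sigma> (empirical_measure n (\<lambda>i. X i \<omega>)) P \<partial>S) \<le> ?rhs"
    proof (cases "CARD('n) \<le> 2")
      case True
      \<comment> \<open>Here \<open>\<sigma>\<close> need not be bounded above, so the smoothing is dropped: it contracts the distance.\<close>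
      interpret R: smoothing_kernel "return borel 0 :: (real ^ 'n) measure"
        by (rule smoothing_kernel_return)
      interpret G: smoothing_kernel "isotropic_gaussian \<sigma> :: (real ^ 'n) measure"
        by (rule smoothing_kernel_gaussian[OF \<sigma>])
      have "(\<integral>\<^sup>+\<omega>. smooth_wasserstein1 \<sigma> (empirical_measure n (\<lambda>i. X i \<omega>)) P \<partial>S)
        \<le> (\<integral>\<^sup>+\<omega>. wasserstein1 (empirical_measure n (\<lambda>i. X i \<omega>)) P \<partial>S)"
        unfolding smooth_wasserstein1_def using P G.prob_space_axioms G.sets_kernel prob_emp
        by (intro nn_integral_mono wasserstein1_convolution_le) auto
      also have "\<dots> = (\<integral>\<^sup>+\<omega>. wasserstein1 (empirical_measure n (\<lambda>i. X i \<omega>) \<star> return borel 0) (P \<star> return borel 0) \<partial>S)"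
        using P prob_emp by (simp add: convolution_return_0)
      also have "\<dots> \<le> ?rhs"
        unfolding C_def
      proof (rule R.expected_wasserstein1_partition[where s = "\<lambda>_. 1" and \<Lambda> = 1,
          OF P I ne K M M1 summable _ V0 S n])
        note [measurable] = borel_measurable_vec_nth
        show "(\<integral>\<^sup>+z. ennreal (exp (4 * (\<Sum>i\<in>UNIV. \<bar>z $ i\<bar>))) \<partial>(return borel 0 :: (real ^ 'n) measure)) \<le> ennreal V"
          using V1 by (subst nn_integral_return) (auto simp: ennreal_leI)
        \<comment> \<open>The count of subcells is at most 4^k in dimension at most 2, so the side
          of the cells balances its square root without help from the noise.\<close>
        show "1 * 2 ^ (k * CARD('n)) \<le> ((1::real) * 2 ^ k)\<^sup>2" for k
        proof -
          have "(2::real) ^ (k * CARD('n)) \<le> 2 ^ (k * 2)"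
            using True by (intro power_increasing mult_left_mono) auto
          then show ?thesis by (simp add: power_mult)
        qed
        have "0 < D" using \<open>c > 0\<close> D by simp
        have "1 \<le> D / c" using \<open>c > 0\<close> D by simp
        then show "1 \<le> (1 + 1 / c) * D"
          using \<open>0 < D\<close> by (simp add: distrib_right)
      qed (use \<open>c > 0\<close> D R.shifted_le_1 in auto)
      finally show ?thesis .
    next
      case False
      then have d: "2 \<le> CARD('n)" "2 < real CARD('n)" by auto
      interpret G: smoothing_kernel "isotropic_gaussian \<sigma> :: (real ^ 'n) measure"
        by (rule smoothing_kernel_gaussian[OF \<sigma>])
      \<comment> \<open>The exponent of \<open>\<sigma>\<close> is negative, so \<open>c \<le> D\<close> bounds \<open>\<sigma>\<close> and hence the exponential moment.\<close>
      have "\<sigma> \<le> \<sigma>\<^sub>0"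
      proof -
        have "D powr (1 / (- real CARD('n) / 2 + 1)) \<le> \<sigma>\<^sub>0"
          unfolding \<sigma>\<^sub>0_def using \<open>c > 0\<close> D d by (intro powr_mono2') (auto simp: field_simps)
        also have "D powr (1 / (- real CARD('n) / 2 + 1)) = \<sigma>"
          using \<sigma> d by (simp add: D_def powr_powr)
        finally show ?thesis .
      qed
      then have "exp (8 * \<sigma>\<^sup>2) \<le> exp (8 * \<sigma>\<^sub>0\<^sup>2)"
        using \<sigma> by (simp add: power_mono)
      then have moment: "(\<integral>\<^sup>+z. ennreal (exp (4 * (\<Sum>i\<in>UNIV. \<bar>z $ i\<bar>))) \<partial>(isotropic_gaussian \<sigma> :: (real ^ 'n) measure)) \<le> ennreal V"
        unfolding V_def by (intro order_trans[OF gaussian_exp_moment[OF \<sigma>]] ennreal_leI power_mono) auto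
      have "0 < D" using \<open>c > 0\<close> D by simp
      show ?thesis
        unfolding smooth_wasserstein1_def C_def
      proof (rule G.expected_wasserstein1_partition[OF P I ne K M M1 summable moment V0 S n])
        show "G.shifted (dyadic_cell k -` {b}) x \<le> min 1 (1 / (2 ^ k * \<sigma>) ^ CARD('n))" for k b x
          using gaussian_cell_le[OF \<sigma>, of x k b] G.shifted_le_1 by (simp add: G.shifted_def)
        show "min 1 (1 / (2 ^ k * \<sigma>) ^ CARD('n)) * 2 ^ (k * CARD('n)) \<le> (D * 2 ^ k)\<^sup>2" for k
          unfolding D_def by (rule gaussian_scale_balance[OF \<sigma> d(1)])
        show "D \<le> (1 + 1 / c) * D"
          using \<open>c > 0\<close> \<open>0 < D\<close> by (simp add: field_simps)
      qed (use \<open>c > 0\<close> D \<open>0 < D\<close> in auto)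
    qed
    then show "(\<integral>\<^sup>+ \<omega>. smooth_wasserstein1 \<sigma> (empirical_measure n (\<lambda>i. X i \<omega>)) P \<partial>S)
        \<le> ennreal ((CARD('n) / c + 4 * CARD('n) * (1 + 1 / c) * C + 2 * C / c) / ln 2
          * (\<sigma> powr (- real CARD('n) / 2 + 1) * ln (real n) / sqrt (real n)
            * (\<Sum>j. (SUP x\<in>I j. norm x) * sqrt (measure P (I j)))))"
      by (simp add: D_def M_def)
  qed
qed

end
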